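(* Suppose that $a\in(0,1)$ and $\rho\in[0,1)$ with $\rho$ rational, and let $b\in[0,1)$. Then $f_\pm$ has rotation number $\rho(f_\pm)=\rho$ if and only if one of the following three cases holds, and in each case the stated properties hold. (i) $b=b_-(a,\rho)$. Then $f_\pm$ has a unique periodic orbit $C$, with $0\in C$ but $1\notin C$. $C$ is also a periodic orbit of $f_-$, but $f_+$ has no periodic orbit. Furthermore, $\Lambda_-=C$, while $\Lambda_+=\emptyset$ and $\Lambda_\pm=C\cup O_1$, where $O_1$ is the (unique) orbit of $1$ under $f_\pm$. (ii) $b_-(a,\rho)<b<b_+(a,\rho)$. Then $f_\pm$ has a unique periodic orbit $C$, with $0,1\notin C$. Furthermore, $\Lambda_\pm=\Lambda_+=\Lambda_-=C$. (iii) $b=b_+(a,\rho)$. Then $f_\pm$ has a unique periodic orbit $C$, with $1\in C$ but $0\notin C$. $C$ is also a periodic orbit of $f_+$, but $f_-$ has no periodic orbit. Furthermore, $\Lambda_+=C$, while $\Lambda_-=\emptyset$ and $\Lambda_\pm=C\cup O_0$, where $O_0$ is the (unique) orbit of $0$ under $f_\pm$. In all three cases, every orbit of $f_\pm$ converges to $C$, so $\omega_{f_\pm}(x)=\omega_{f_-}(x)=\omega_{f_+}(x)=C$ for every $x\in[0,1]$.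
   Context: For real $x$ let $\{x\}:=x-\lfloor x\rfloor\in[0,1)$ and $\{x\}_+:=1-\{-x\}\in(0,1]$. For constants $0<a<1$, $0\le b<1$ define $f_-,f_+:[0,1]\to[0,1]$ by $f_-(x)=\{ax+b\}$, $f_+(x)=\{ax+b\}_+$, and let $f_\pm$ be the multi-valued map $x\mapsto\{f_-(x),f_+(x)\}$. For $K\subseteq[0,1]$, $f_\pm(K):=f_-(K)\cup f_+(K)$. An orbit of $x\in[0,1]$ under $f_\pm$ is any sequence $(x_n)_{n\ge0}$ with $x_0=x$ and $x_{n+1}\in f_\pm(x_n)$ for all $n\ge0$ (for $f_-$ or $f_+$ alone, orbits are the usual ones). A periodic orbit is an orbit with $x_{n+q}=x_n$ for some $q\ge1$ and all $n\ge0$; it is written, and identified with, the set $\{x_0,\dots,x_{q-1}\}$. An orbit $(x_n)$ converges to a periodic orbit $C=\{y_0,\dots,y_{k-1}\}$ (points listed in the order visited) if there exists $j$ such that $x_n-y_{(j+n)\bmod k}\to0$ as $n\to\infty$. Invariant sets: $\Lambda_\pm:=\bigcap_{n\ge0}f_\pm^n([0,1])$, $\Lambda_-:=\bigcap_{n\ge0}f_-^n([0,1])$, $\Lambda_+:=\bigcap_{n\ge0}f_+^n([0,1])$. Limit sets: for $g\in\{f_-,f_+,f_\pm\}$, $\omega_g(x)$ is the set of all $p$ such that some orbit of $x$ under $g$ has a subsequence converging to $p$. Rotation number: let $F_-(x):=ax+b+(1-a)\lfloor x\rfloor$ and $F_+(x):=ax+b-(1-a)\lfloor 1-x\rfloor$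 for $x\in\mathbb R$. The rotation number $\rho(f_\pm)\in[0,1)$ is the number such that $F_-^n(x)/n\to\rho(f_\pm)$ and $F_+^n(x)/n\to\rho(f_\pm)$ as $n\to\infty$ for every $x\in\mathbb R$ (the limits exist, coincide and do not depend on $x$). Finally, $$b_-(a,\rho):=(1-a)^2\sum_{j=0}^\infty a^j\lceil(j+1)\rho\rceil,\qquad b_+(a,\rho):=1-a+(1-a)^2\sum_{j=0}^\infty a^j\lfloor(j+1)\rho\rfloor .$$ *)

theory Defs
  imports Complex_Main
begin

definition frac_plus :: "real \<Rightarrow> real" where
  "frac_plus x = 1 - frac (- x)"

definition f_minus :: "real \<Rightarrow> real \<Rightarrow> real \<Rightarrow> real" where
  "f_minus a b x = frac (a * x + b)"

definition f_plus :: "real \<Rightarrow> real \<Rightarrow> real \<Rightarrow> real" where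
  "f_plus a b x = frac_plus (a * x + b)"

(* Multi-valued maps are functions into sets, and a single-valued map is identified with the
   map into singletons. The maps are total on the reals; the restriction to [0,1] is made
   in the notions below. *)
type_synonym multimap = "real \<Rightarrow> real set"

definition single :: "(real \<Rightarrow> real) \<Rightarrow> multimap" where
  "single f x = {f x}"

definition f_pm :: "real \<Rightarrow> real \<Rightarrow> multimap" where
  "f_pm a b x = {f_minus a b x, f_plus a b x}"

definition orbits :: "multimap \<Rightarrow> real \<Rightarrow> (nat \<Rightarrow> real) set" where
  "orbits g x = {s. x \<in> {0..1} \<and> s 0 = x \<and> (\<forall>n. s (Suc n) \<in> g (s n))}"

definition periodic_seq :: "multimap \<Rightarrow> (nat \<Rightarrow> real) \<Rightarrow> nat \<Rightarrow> bool" where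
  "periodic_seq g y q \<longleftrightarrow> y \<in> orbits g (y 0) \<and> q \<ge> 1 \<and> (\<forall>n. y (n + q) = y n)"

definition periodic_orbit :: "multimap \<Rightarrow> real set \<Rightarrow> bool" where
  "periodic_orbit g C \<longleftrightarrow> (\<exists>y q. periodic_seq g y q \<and> C = y ` {..<q})"

definition unique_periodic_orbit :: "multimap \<Rightarrow> real set \<Rightarrow> bool" where
  "unique_periodic_orbit g C \<longleftrightarrow>
     periodic_orbit g C \<and> (\<forall>D. periodic_orbit g D \<longrightarrow> D = C)"

(* Periodic orbits are identified with sets, so convergence is required with respect to every
   way of listing C in the order in which some periodic sequence visits it. *)
definition converges_to_periodic_orbit ::
    "multimap \<Rightarrow> (nat \<Rightarrow> real) \<Rightarrow> real set \<Rightarrow> bool" where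
  "converges_to_periodic_orbit g s C \<longleftrightarrow> periodic_orbit g C \<and>
     (\<forall>y k. periodic_seq g y k \<and> C = y ` {..<k} \<longrightarrow>
        (\<exists>j. (\<lambda>n. s n - y ((j + n) mod k)) \<longlonglongrightarrow> 0))"

definition set_image :: "multimap \<Rightarrow> real set \<Rightarrow> real set" where
  "set_image g K = (\<Union>x\<in>K. g x)"

definition invariant_set :: "multimap \<Rightarrow> real set" where
  "invariant_set g = (\<Inter>n. (set_image g ^^ n) {0..1})"

definition omega_limit :: "multimap \<Rightarrow> real \<Rightarrow> real set" where
  "omega_limit g x =
     {p. \<exists>s \<in> orbits g x. \<exists>r :: nat \<Rightarrow> nat. strict_mono r \<and> (s \<circ> r) \<longlonglongrightarrow> p}"

definition lift_minus :: "real \<Rightarrow> real \<Rightarrow> real \<Rightarrow> real" where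
  "lift_minus a b x = a * x + b + (1 - a) * of_int \<lfloor>x\<rfloor>"

definition lift_plus :: "real \<Rightarrow> real \<Rightarrow> real \<Rightarrow> real" where
  "lift_plus a b x = a * x + b - (1 - a) * of_int \<lfloor>1 - x\<rfloor>"

definition has_rotation_number :: "real \<Rightarrow> real \<Rightarrow> real \<Rightarrow> bool" where
  "has_rotation_number a b r \<longleftrightarrow> 0 \<le> r \<and> r < 1 \<and>
     (\<forall>x. (\<lambda>n. (lift_minus a b ^^ n) x / of_nat n) \<longlonglongrightarrow> r) \<and>
     (\<forall>x. (\<lambda>n. (lift_plus a b ^^ n) x / of_nat n) \<longlonglongrightarrow> r)"

definition b_minus :: "real \<Rightarrow> real \<Rightarrow> real" where
  "b_minus a \<rho> = (1 - a)\<^sup>2 * (\<Sum>j. a ^ j * of_int \<lceil>(of_nat j + 1) * \<rho>\<rceil>)"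

definition b_plus :: "real \<Rightarrow> real \<Rightarrow> real" where
  "b_plus a \<rho> = 1 - a + (1 - a)\<^sup>2 * (\<Sum>j. a ^ j * of_int \<lfloor>(of_nat j + 1) * \<rho>\<rfloor>)"

end

theory Submission
  imports Defs "HOL-Number_Theory.Cong"
begin

text \<open>
Write \<open>\<rho> = p / q\<close> in lowest terms and lift orbits to the real line: they become sequences with
\<open>S (n + 1) = a S n + b + (1 - a) k n\<close>, where \<open>k n\<close> is an integer with
\<open>k n \<le> S n \<le> k n + 1\<close>. Unrolling this recursion for the itinerary \<open>k = \<lfloor>m / q\<rfloor>\<close>
gives an explicit strictly increasing function \<open>phi\<close> on the integers with
\<open>phi (m + p) = a phi m + b + (1 - a) \<lfloor>m / q\<rfloor>\<close> and \<open>phi (m + q) = phi m + 1\<close>. It describes a periodic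
orbit iff \<open>0 \<le> phi 0\<close> and \<open>phi (q - 1) \<le> 1\<close>, which means precisely
\<open>b_- \<le> b \<le> b_+\<close>; the boundary cases are those where the orbit contains 0 or 1.

An orbit starting between \<open>phi m\<close> and \<open>phi (m + 1)\<close> stays between the two shifted points
\<open>phi (m + n p)\<close> and \<open>phi (m + 1 + n p)\<close>, and it has the itinerary of one of them for all times: the first
time the gap contains an integer it falls on one side, and from then on it is contracted towards
the corresponding end. Hence it approaches the periodic orbit like \<open>a ^ n\<close>. Moreover a step
into the periodic orbit can only start on it, which yields the invariant sets. If \<open>b < b_-\<close>,
then comparison with the parameter \<open>b_-\<close>, where the \<open>q\<close>-th iterate of the lift is at most
\<open>x + p\<close>, shows that the rotation number is less than \<open>\<rho>\<close>. The reflection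
\<open>x \<mapsto> 1 - x\<close>, which exchanges \<open>f_-\<close> and \<open>f_+\<close> and replaces \<open>b\<close> by
\<open>1 - a - b\<close> and \<open>p\<close> by \<open>- p\<close>, gives the statements at \<open>b_+\<close>.
\<close>

section \<open>Integer division, summability and periodic sequences\<close>

lemma abs_div_le_abs:
  fixes x q :: int
  assumes "0 < q"
  shows "\<bar>x div q\<bar> \<le> \<bar>x\<bar>"
proof (cases "0 \<le> x")
  case True
  then show ?thesis
    using assms by (simp add: div_le_dividend zdiv_mono2[of x 1 q, simplified] pos_imp_zdiv_nonneg_iff)
next
  case False
  then have "x div 1 \<le> x div q"
    using assms by (intro zdiv_mono2_neg) auto
  moreover have "x div q < 0"
    using False assms by (simp add: neg_imp_zdiv_neg_iff pos_imp_zdiv_neg_iff)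
  ultimately show ?thesis
    using False by simp
qed

text \<open>A remainder \<open>r\<close> turns into \<open>q - 1 - r\<close>. This is the integer
  form of the reflection and yields the duality of \<open>phi\<close>.\<close>

lemma neg_minus_1_div:
  fixes x q :: int
  assumes "0 < q"
  shows "(- x - 1) div q = - (x div q) - 1"
proof (rule int_div_pos_eq)
  have "x = q * (x div q) + x mod q" by simp
  then show "- x - 1 = q * (- (x div q) - 1) + (q - 1 - x mod q)"
    by (simp add: algebra_simps)
qed (use pos_mod_bound[OF assms, of x] pos_mod_sign[OF assms, of x] in linarith)+

lemma div_eq_diff_1_if_dvd:
  fixes m q :: int
  assumes "0 < q" "q dvd m + 1"
  shows "m div q = (m + 1) div q - 1"
proof -
  obtain c where c: "m + 1 = q * c" using assms by (auto simp: dvd_def)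
  then have "m = - (q * (- c)) - 1" by simp
  then have "m div q = - (q * (- c) div q) - 1"
    using neg_minus_1_div[OF assms(1)] by metis
  then show ?thesis
    unfolding c using assms by (simp only: nonzero_mult_div_cancel_left)
qed

text \<open>Unless it is \<open>q - 1\<close>, the remainder has room to grow by 1. So the
  itineraries of neighbouring indices \<open>m\<close> and \<open>m + 1\<close> differ exactly when
  \<open>q dvd m + 1\<close>.\<close>

lemma div_eq_if_not_dvd:
  fixes m q :: int
  assumes "0 < q" "\<not> q dvd m + 1"
  shows "(m + 1) div q = m div q"
proof (rule int_div_pos_eq)
  show "m + 1 = q * (m div q) + (m mod q + 1)" by simp
  show "0 \<le> m mod q + 1" using pos_mod_sign[OF assms(1), of m] by simp
  have "m mod q + 1 \<noteq> q"
  proof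
    assume "m mod q + 1 = q"
    then have "m + 1 = q * (m div q + 1)"
      using mult_div_mod_eq[of q m] distrib_left[of q "m div q" 1] by linarith
    then show False using assms(2) by simp
  qed
  then show "m mod q + 1 < q" using pos_mod_bound[OF assms(1), of m] by simp
qed

text \<open>The quotients grow at most linearly in \<open>j\<close>, so the geometric series and its
  derivative dominate.\<close>

lemma summable_power_times_div:
  fixes a :: real and m p q :: int
  assumes "0 < a" "a < 1" "0 < q"
  shows "summable (\<lambda>j. a ^ j * of_int ((m - (int j + 1) * p) div q))"
proof (rule summable_comparison_test')
  have "summable (\<lambda>j. real (Suc j) * a ^ j)"
    using geometric_deriv_sums[of a] assms by (auto simp: sums_iff)
  then show "summable (\<lambda>j. \<bar>of_int m\<bar> * a ^ j + \<bar>of_int p\<bar> * (real (Suc j) * a ^ j))"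
    using assms by (intro summable_add summable_mult summable_geometric) auto
  fix j :: nat
  have "\<bar>(m - (int j + 1) * p) div q\<bar> \<le> \<bar>m - (int j + 1) * p\<bar>"
    using assms by (intro abs_div_le_abs)
  also have "\<dots> \<le> \<bar>m\<bar> + (int j + 1) * \<bar>p\<bar>"
    using abs_triangle_ineq4[of m "(int j + 1) * p"] by (simp add: abs_mult)
  finally have "real_of_int \<bar>(m - (int j + 1) * p) div q\<bar> \<le> real_of_int (\<bar>m\<bar> + (int j + 1) * \<bar>p\<bar>)"
    by linarith
  then have "a ^ j * \<bar>real_of_int ((m - (int j + 1) * p) div q)\<bar>
      \<le> a ^ j * (\<bar>of_int m\<bar> + real (Suc j) * \<bar>of_int p\<bar>)"
    using assms by (intro mult_left_mono) (auto simp: add.commute)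
  then show "norm (a ^ j * real_of_int ((m - (int j + 1) * p) div q))
      \<le> \<bar>of_int m\<bar> * a ^ j + \<bar>of_int p\<bar> * (real (Suc j) * a ^ j)"
    using assms by (simp add: abs_mult algebra_simps)
qed

lemma periodic_mult:
  fixes d :: "nat \<Rightarrow> 'a"
  assumes "\<And>n. d (n + P) = d n"
  shows "d (n + i * P) = d n"
proof (induction i)
  case (Suc i)
  have "n + Suc i * P = (n + i * P) + P" by simp
  then show ?case using assms Suc by metis
qed simp

lemma periodic_mod:
  fixes d :: "nat \<Rightarrow> 'a"
  assumes "\<And>n. d (n + P) = d n"
  shows "d (n mod P) = d n"
  using periodic_mult[of d P "n mod P" "n div P"] assms by simp

lemma periodic_tendsto_0:
  fixes d :: "nat \<Rightarrow> real"
  assumes "\<And>n. d (n + P) = d n" "0 < P" "d \<longlonglongrightarrow> 0"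
  shows "d n = 0"
proof -
  have "strict_mono (\<lambda>i. n + i * P)"
    using assms by (auto simp: strict_mono_def)
  from LIMSEQ_subseq_LIMSEQ[OF assms(3) this] have "(\<lambda>i. d (n + i * P)) \<longlonglongrightarrow> 0"
    by (simp add: o_def)
  moreover have "d (n + i * P) = d n" for i
    by (rule periodic_mult) (rule assms)
  ultimately show ?thesis by (simp add: LIMSEQ_const_iff)
qed

text \<open>
If \<open>S n\<close> is an integer, then \<open>k n\<close> may be \<open>S n\<close> or \<open>S n - 1\<close>: this is the choice
between the two branches at a discontinuity.
\<close>
definition lifted_orbit :: "real \<Rightarrow> real \<Rightarrow> (nat \<Rightarrow> real) \<Rightarrow> (nat \<Rightarrow> int) \<Rightarrow> bool" where
  "lifted_orbit a b S k \<longleftrightarrow> (\<forall>n. S (Suc n) = a * S n + b + (1 - a) * of_int (k n) \<and>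
     of_int (k n) \<le> S n \<and> S n \<le> of_int (k n) + 1)"

lemma lifted_orbit_shift:
  "lifted_orbit a b S k \<Longrightarrow> lifted_orbit a b (\<lambda>n. S (n + i)) (\<lambda>n. k (n + i))"
  by (simp add: lifted_orbit_def)

text \<open>Negation maps the closed interval from \<open>k\<close> to \<open>k + 1\<close> onto the
  one from \<open>- k - 1\<close> to \<open>- k\<close>; a half-open interval would not survive the
  sign change.\<close>

lemma lifted_orbit_dual:
  "lifted_orbit a b S k \<Longrightarrow> lifted_orbit a (1 - a - b) (\<lambda>n. - S n) (\<lambda>n. - k n - 1)"
  by (auto simp: lifted_orbit_def algebra_simps)

text \<open>
Here \<open>b\<close> is any real and \<open>p\<close> any integer, so that the locale is closed under the reflection
\<open>(b, p) \<mapsto> (1 - a - b, - p)\<close>.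
\<close>
locale rotation =
  fixes a b :: real and p q :: int
  assumes a_pos: "0 < a" and a_less_1: "a < 1" and q_pos: "0 < q" and coprime_pq: "coprime p q"
begin

text \<open>The point visited by the orbit with itinerary \<open>(m + n p) div q\<close> at time 0.\<close>
definition phi :: "int \<Rightarrow> real" where
  "phi m = b / (1 - a) + (1 - a) * (\<Sum>j. a ^ j * of_int ((m - (int j + 1) * p) div q))"

section \<open>Recursion, translation, order and duality of \<open>phi\<close>\<close>

lemma summable_phi: "summable (\<lambda>j. a ^ j * real_of_int ((m - (int j + 1) * p) div q))"
  using a_pos a_less_1 q_pos by (rule summable_power_times_div)

text \<open>The head of the series for \<open>m + p\<close> is \<open>m div q\<close>, and its tail
  is \<open>a\<close> times the series for \<open>m\<close>; the constant \<open>b / (1 - a)\<close>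
  is the fixed point of \<open>x \<mapsto> a x + b\<close>.\<close>

lemma phi_step: "phi (m + p) = a * phi m + b + (1 - a) * of_int (m div q)"
proof -
  define t where "t = (\<lambda>j. a ^ j * real_of_int ((m - (int j + 1) * p) div q))"
  have eq: "a ^ Suc j * real_of_int ((m + p - (int (Suc j) + 1) * p) div q) = a * t j" for j
    by (simp add: t_def algebra_simps)
  have "(\<Sum>j. a ^ j * real_of_int ((m + p - (int j + 1) * p) div q)) = of_int (m div q) + a * suminf t"
    using suminf_split_head[OF summable_phi[of "m + p"]] suminf_mult[of t a] summable_phi[of m]
    unfolding eq by (simp add: t_def)
  moreover define c where "c = b / (1 - a)"
  moreover have "c = a * c + b"
    using a_less_1 by (simp add: c_def field_simps)
  ultimately show ?thesis
    unfolding phi_def c_def[symmetric] t_def[symmetric] by (simp add: algebra_simps)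
qed

lemma phi_add_q: "phi (m + q) = phi m + 1"
proof -
  have eq: "(m + q - x) div q = (m - x) div q + 1" for x
    using q_pos div_add_self2[of q "m - x"] by (simp add: algebra_simps)
  have "(\<Sum>j. a ^ j * real_of_int ((m + q - (int j + 1) * p) div q))
      = (\<Sum>j. a ^ j * real_of_int ((m - (int j + 1) * p) div q) + a ^ j)"
    by (simp only: eq) (simp add: algebra_simps)
  also have "\<dots> = (\<Sum>j. a ^ j * real_of_int ((m - (int j + 1) * p) div q)) + (\<Sum>j. a ^ j)"
    using a_pos a_less_1 by (intro suminf_add[symmetric] summable_phi summable_geometric) auto
  also have "(\<Sum>j. a ^ j) = 1 / (1 - a)"
    using a_pos a_less_1 by (intro suminf_geometric) auto
  finally show ?thesis
    using a_less_1 by (simp add: phi_def algebra_simps)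
qed

lemma phi_add_mult: "phi (m + i * q) = phi m + of_int i"
proof (induction i rule: int_induct[where k = 0])
  case (step1 i)
  have "phi (m + i * q + q) = phi (m + i * q) + 1" by (rule phi_add_q)
  then show ?case using step1 by (simp add: algebra_simps)
next
  case (step2 i)
  have "phi (m + (i - 1) * q + q) = phi (m + (i - 1) * q) + 1" by (rule phi_add_q)
  then show ?case using step2 by (simp add: algebra_simps)
qed simp

lemma phi_mod: "phi m = phi (m mod q) + of_int (m div q)"
  using phi_add_mult[of "m mod q" "m div q"] by simp

text \<open>With an inverse \<open>x\<close> of \<open>p\<close> modulo \<open>q\<close>, take for
  \<open>n\<close> the residue of \<open>- (x * i)\<close>.\<close>

lemma ex_dvd_add_mult: "\<exists>n::nat. int n < q \<and> q dvd i + int n * p"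
proof -
  obtain x where x: "[p * x = 1] (mod q)"
    using cong_solve_coprime_int[OF coprime_pq] by blast
  define n where "n = nat ((- (x * i)) mod q)"
  have n: "int n = (- (x * i)) mod q" "int n < q"
    using q_pos by (auto simp: n_def)
  have "[i + int n * p = i + (- (x * i)) * p] (mod q)"
    unfolding n by (intro cong_add cong_mult cong_refl) simp
  also have "i + (- (x * i)) * p = i * (1 - p * x)" by (simp add: algebra_simps)
  also have "[i * (1 - p * x) = i * (1 - 1)] (mod q)"
    by (intro cong_mult cong_diff cong_refl x)
  finally show ?thesis
    using n by (intro exI[of _ n]) (simp add: cong_0_iff)
qed

text \<open>All terms of the series are weakly increasing in the index. By coprimality some
  \<open>n\<close> satisfies \<open>q dvd m + 1 - (n + 1) p\<close>, and there the quotient jumps by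
  1, which makes the inequality strict.\<close>

lemma phi_less_Suc: "phi m < phi (m + 1)"
proof -
  let ?t = "\<lambda>m j. a ^ j * real_of_int ((m - (int j + 1) * p) div q)"
  obtain n where "q dvd (- m - 1 + p) + int n * p"
    using ex_dvd_add_mult by blast
  then have "q dvd (m + 1) - (int n + 1) * p"
    using dvd_minus_iff[of q "m + 1 - (int n + 1) * p"] by (simp add: algebra_simps)
  then obtain c where c: "m + 1 - (int n + 1) * p = q * c" by (auto simp: dvd_def)
  have "(m - (int n + 1) * p) div q = (- (q * (- c)) - 1) div q"
    using c by (intro arg_cong[of _ _ "\<lambda>x. x div q"]) linarith
  also have "\<dots> = c - 1"
    using q_pos neg_minus_1_div[of q "q * (- c)"] nonzero_mult_div_cancel_left[of q "- c"] by linarith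
  finally have strict: "0 < ?t (m + 1) n - ?t m n"
    using c q_pos a_pos by (simp add: algebra_simps)
  have "0 \<le> ?t (m + 1) j - ?t m j" for j
  proof -
    have "(m - (int j + 1) * p) div q \<le> (m + 1 - (int j + 1) * p) div q"
      using q_pos by (intro zdiv_mono1) auto
    then show ?thesis using a_pos by simp
  qed
  then have "0 < (\<Sum>j. ?t (m + 1) j - ?t m j)"
    using strict by (intro suminf_pos2[of _ n] summable_diff summable_phi) auto
  then have "(\<Sum>j. ?t m j) < (\<Sum>j. ?t (m + 1) j)"
    using suminf_diff[OF summable_phi[of "m + 1"] summable_phi[of m]] by simp
  then show ?thesis
    using a_less_1 by (simp add: phi_def)
qed

lemma phi_less: "m < m' \<Longrightarrow> phi m < phi m'"
  by (induction m' rule: int_gr_induct) (auto intro: phi_less_Suc less_trans)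

lemma phi_less_iff: "phi m < phi m' \<longleftrightarrow> m < m'"
  by (metis phi_less less_asym linorder_neqE)

lemma phi_le_iff: "phi m \<le> phi m' \<longleftrightarrow> m \<le> m'"
  by (simp add: phi_less_iff flip: not_less)

lemma phi_inj: "phi m = phi m' \<longleftrightarrow> m = m'"
  by (metis order.refl phi_le_iff antisym)

lemma phi_bracket: obtains m where "phi m \<le> x" "x < phi (m + 1)"
proof -
  define i where "i = \<lfloor>x - phi 0\<rfloor>"
  \<comment> \<open>From \<open>phi (i * q)\<close> to \<open>phi ((i + 1) * q)\<close> there are
    finitely many values of \<open>phi\<close>; the first one above \<open>x\<close> closes the
    bracket.\<close>
  define r where "r = (LEAST r. x < phi (i * q + int r))"
  have "x < phi ((i + 1) * q)" and lo: "phi (i * q) \<le> x"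
    using phi_add_mult[of 0 i] phi_add_mult[of 0 "i + 1"] unfolding i_def
    by (simp_all, linarith+)
  then have "x < phi (i * q + int (nat q))"
    using q_pos by (simp add: algebra_simps)
  then have r: "x < phi (i * q + int r)"
    unfolding r_def by (rule LeastI)
  with lo have "r \<noteq> 0" by (intro notI) simp
  then have "\<not> x < phi (i * q + int (r - 1))"
    unfolding r_def by (intro not_less_Least) simp
  then show ?thesis
    using r \<open>r \<noteq> 0\<close> by (intro that[of "i * q + int (r - 1)"]) (auto simp: of_nat_diff algebra_simps)
qed

lemma phi_dual_rotation: "rotation a (- p) q"
  using a_pos a_less_1 q_pos coprime_pq by unfold_locales auto

text \<open>Each quotient changes sign and loses 1 by \<open>neg_minus_1_div\<close>; the lost units
  sum to a geometric series, which cancels the change in the constant term.\<close>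

lemma phi_dual: "rotation.phi a (1 - a - b) (- p) q m = - phi (- m - 1)"
proof -
  interpret dual: rotation a "1 - a - b" "- p" q by (rule phi_dual_rotation)
  have eq: "(- m - 1 - (int j + 1) * p) div q = - ((m - (int j + 1) * - p) div q) - 1" for j
    using neg_minus_1_div[OF q_pos, of "m - (int j + 1) * - p"] by (simp add: algebra_simps)
  have "(\<Sum>j. a ^ j * real_of_int ((- m - 1 - (int j + 1) * p) div q))
      = (\<Sum>j. - (a ^ j * real_of_int ((m - (int j + 1) * - p) div q)) - a ^ j)"
    by (simp only: eq) (simp add: algebra_simps)
  also have "\<dots> = - (\<Sum>j. a ^ j * real_of_int ((m - (int j + 1) * - p) div q)) - (\<Sum>j. a ^ j)"
    using a_pos a_less_1
    by (subst suminf_minus[OF dual.summable_phi, symmetric], subst suminf_diff)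
      (intro summable_minus dual.summable_phi summable_geometric, auto)
  also have "(\<Sum>j. a ^ j) = 1 / (1 - a)"
    using a_pos a_less_1 by (intro suminf_geometric) auto
  finally have "(1 - a) * (\<Sum>j. a ^ j * real_of_int ((- m - 1 - (int j + 1) * p) div q))
      = - ((1 - a) * (\<Sum>j. a ^ j * real_of_int ((m - (int j + 1) * - p) div q))) - 1"
    using a_less_1 by (simp add: right_diff_distrib del: minus_mult_minus mult_minus_right)
  moreover have "(1 - a - b) / (1 - a) = 1 - b / (1 - a)"
    using a_less_1 by (simp add: diff_divide_distrib)
  ultimately show ?thesis
    unfolding phi_def dual.phi_def by linarith
qed

text \<open>With equal itineraries both sequences obey the same affine recursion of slope
  \<open>a\<close>.\<close>

lemma lifted_orbit_affine:
  assumes "lifted_orbit a b S k" "\<And>n. k n = (m + int n * p) div q"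
  shows "S n - phi (m + int n * p) = a ^ n * (S 0 - phi m)"
proof (induction n)
  case (Suc n)
  have "phi (m + int (Suc n) * p) = a * phi (m + int n * p) + b + (1 - a) * of_int (k n)"
    using phi_step[of "m + int n * p"] assms(2) by (simp add: algebra_simps)
  moreover have "S (Suc n) = a * S n + b + (1 - a) * of_int (k n)"
    using assms(1) by (simp add: lifted_orbit_def)
  ultimately have "S (Suc n) - phi (m + int (Suc n) * p) = a * (S n - phi (m + int n * p))"
    by (simp add: right_diff_distrib)
  then show ?case using Suc by simp
qed simp

end

section \<open>Lifted orbits\<close>

text \<open>By monotonicity and \<open>phi_add_q\<close> the two bounds place every
  \<open>phi m\<close> between \<open>m div q\<close> and \<open>m div q + 1\<close>. Hence
  \<open>phi (m + n p)\<close> is itself a lifted orbit, with itinerary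
  \<open>(m + n p) div q\<close>.\<close>

locale locked_rotation = rotation +
  assumes phi_0_nonneg: "0 \<le> phi 0" and phi_q_le_1: "phi (q - 1) \<le> 1"
begin

lemma phi_ge_div: "of_int (m div q) \<le> phi m"
  using phi_mod[of m] phi_le_iff[of 0 "m mod q"] phi_0_nonneg pos_mod_sign[OF q_pos, of m] by simp

lemma phi_le_div: "phi m \<le> of_int (m div q) + 1"
  using phi_mod[of m] phi_le_iff[of "m mod q" "q - 1"] phi_q_le_1 pos_mod_bound[OF q_pos, of m] by simp

lemma dual_locked: "locked_rotation a (1 - a - b) (- p) q"
proof -
  interpret dual: rotation a "1 - a - b" "- p" q by (rule phi_dual_rotation)
  show ?thesis
    using phi_0_nonneg phi_q_le_1 phi_add_q[of "-1"] phi_add_q[of "- q"]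
    by unfold_locales (auto simp: phi_dual)
qed

text \<open>A wrong \<open>k\<close> would put \<open>x\<close> and \<open>phi i\<close> on opposite
  sides of an integer (or on it), and then \<open>a (x - phi i)\<close> and
  \<open>(1 - a) (i div q - k)\<close> could not be equal by sign. This makes
  \<open>range phi\<close> backward invariant.\<close>

lemma lift_backward:
  assumes "of_int k \<le> x" "x \<le> of_int k + 1"
    and "a * x + b + (1 - a) * of_int k = phi (i + p)"
  shows "x = phi i \<and> k = i div q"
proof -
  have eq: "a * (x - phi i) = (1 - a) * of_int (i div q - k)"
    using assms(3) phi_step[of i] by (simp add: algebra_simps)
  have "k = i div q"
  proof (rule ccontr)
    assume "k \<noteq> i div q"
    then consider "k + 1 \<le> i div q" | "i div q + 1 \<le> k" by linarith
    then show False
    proof cases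
      case 1
      then have "real_of_int k + 1 \<le> of_int (i div q)" by linarith
      then have "x - phi i \<le> 0" "0 < real_of_int (i div q - k)"
        using phi_ge_div[of i] assms(2) by auto
      then show False
        using eq a_pos a_less_1 mult_pos_pos[of "1 - a" "real_of_int (i div q - k)"]
          mult_nonneg_nonpos[of a "x - phi i"] by linarith
    next
      case 2
      then have "real_of_int (i div q) + 1 \<le> of_int k" by linarith
      then have "0 \<le> x - phi i" "real_of_int (i div q - k) < 0"
        using phi_le_div[of i] assms(1) by auto
      then show False
        using eq a_pos a_less_1 mult_pos_neg[of "1 - a" "real_of_int (i div q - k)"]
          mult_nonneg_nonneg[of a "x - phi i"] by linarith
    qed
  qed
  with eq show ?thesis using a_pos by simp
qed

text \<open>The digit \<open>k n\<close> lies between the quotients of the two enclosing indices, so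
  the step preserves both strict inequalities.\<close>

lemma gap_invariant:
  assumes "lifted_orbit a b S k" "phi m < S 0" "S 0 < phi (m + 1)"
  shows "phi (m + int n * p) < S n \<and> S n < phi (m + 1 + int n * p)"
proof (induction n)
  case (Suc n)
  let ?j = "m + int n * p"
  have S: "S (Suc n) = a * S n + b + (1 - a) * of_int (k n)"
    "of_int (k n) \<le> S n" "S n \<le> of_int (k n) + 1"
    using assms(1) by (auto simp: lifted_orbit_def)
  have "real_of_int (?j div q) < of_int (k n) + 1" "real_of_int (k n) < of_int ((?j + 1) div q) + 1"
    using S Suc phi_ge_div[of ?j] phi_le_div[of "?j + 1"] by (auto simp: algebra_simps)
  then have k: "?j div q \<le> k n" "k n \<le> (?j + 1) div q"
    by linarith+
  have "phi (?j + p) < S (Suc n)"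
    unfolding S phi_step using Suc k a_pos a_less_1
    by (intro add_less_le_mono add_strict_right_mono mult_strict_left_mono mult_left_mono) auto
  moreover have "S (Suc n) < phi (?j + 1 + p)"
    unfolding S phi_step using Suc k a_pos a_less_1
    by (intro add_less_le_mono add_strict_right_mono mult_strict_left_mono mult_left_mono)
      (auto simp: algebra_simps)
  ultimately show ?case by (simp add: algebra_simps)
qed (use assms in simp)

text \<open>The digit lies between \<open>m div q\<close> and \<open>(m + 1) div q\<close>, which
  differ by at most 1. A real choice arises only if \<open>q dvd m + 1\<close>.\<close>

lemma gap_choice:
  assumes "lifted_orbit a b S k" "phi m < S n" "S n < phi (m + 1)"
  shows "k n = m div q \<or> k n = (m + 1) div q"
proof -
  have "real_of_int (m div q) < of_int (k n) + 1" "real_of_int (k n) < of_int ((m + 1) div q) + 1"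
    using assms phi_ge_div[of m] phi_le_div[of "m + 1"] unfolding lifted_orbit_def
    by (smt (verit))+
  then have "m div q \<le> k n" "k n \<le> (m + 1) div q"
    by linarith+
  then show ?thesis
    using div_eq_diff_1_if_dvd[OF q_pos, of m] div_eq_if_not_dvd[OF q_pos, of m] by linarith
qed

text \<open>Once the lower digit is taken at a time where the two candidates differ, the orbit
  contracts towards the lower end of its gap. At every later such time the integer is equally far
  from that end, so the orbit is still below it and the lower digit is forced.\<close>

lemma lower_forever:
  assumes orb: "lifted_orbit a b S k" and S0: "phi m < S 0" "S 0 < phi (m + 1)"
    and n0: "k n0 = (m + int n0 * p) div q" "q dvd m + int n0 * p + 1"
    and "n0 \<le> n"
  shows "k n = (m + int n * p) div q"
proof -
  \<comment> \<open>\<open>L\<close> is the distance from the lower end of the gap to the integer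
    inside it; by \<open>phi_add_mult\<close> it is the same at all times where the digits
    differ.\<close>
  define L where "L = 1 - phi (q - 1)"
  have hit: "S n - phi (m + int n * p) \<le> L \<longleftrightarrow> S n \<le> of_int ((m + int n * p) div q) + 1"
    "S n - phi (m + int n * p) < L \<longleftrightarrow> S n < of_int ((m + int n * p) div q) + 1"
    if dvd: "q dvd m + int n * p + 1" for n
  proof -
    obtain c where c: "m + int n * p + 1 = q * c" using dvd by (auto simp: dvd_def)
    then have "(m + int n * p) div q = c - 1"
      using div_eq_diff_1_if_dvd[OF q_pos dvd] q_pos by simp
    moreover have "m + int n * p = q - 1 + (c - 1) * q"
      using c by (simp add: algebra_simps)
    then have "phi (m + int n * p) = phi (q - 1) + of_int (c - 1)"
      by (simp only: phi_add_mult)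
    ultimately show "S n - phi (m + int n * p) \<le> L \<longleftrightarrow> S n \<le> of_int ((m + int n * p) div q) + 1"
      "S n - phi (m + int n * p) < L \<longleftrightarrow> S n < of_int ((m + int n * p) div q) + 1"
      by (auto simp: L_def)
  qed
  have gap: "phi (m + int n * p) < S n" "S n < phi (m + int n * p + 1)" for n
    using gap_invariant[OF orb S0, of n] by (auto simp: algebra_simps)
  from \<open>n0 \<le> n\<close> have "k n = (m + int n * p) div q \<and> S n - phi (m + int n * p) \<le> L"
  proof (induction n rule: dec_induct)
    case base
    have "S n0 \<le> of_int (k n0) + 1" using orb by (auto simp: lifted_orbit_def)
    then show ?case using n0 hit(1)[OF n0(2)] by simp
  next
    case (step n)
    have "S (Suc n) = a * S n + b + (1 - a) * of_int (k n)"
      using orb by (simp add: lifted_orbit_def)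
    then have "S (Suc n) - phi (m + int n * p + p) = a * (S n - phi (m + int n * p))"
      using step phi_step[of "m + int n * p"] by (simp add: right_diff_distrib)
    also have "\<dots> < 1 * (S n - phi (m + int n * p))"
      using gap[of n] a_less_1 by (intro mult_strict_right_mono) auto
    finally have less: "S (Suc n) - phi (m + int (Suc n) * p) < L"
      using step by (simp add: algebra_simps)
    have "k (Suc n) = (m + int (Suc n) * p) div q"
    proof (cases "q dvd m + int (Suc n) * p + 1")
      case True
      have "real_of_int (k (Suc n)) \<le> S (Suc n)" using orb unfolding lifted_orbit_def by blast
      then have "real_of_int (k (Suc n)) < of_int ((m + int (Suc n) * p) div q) + 1"
        using less hit(2)[OF True] by simp
      moreover have "real_of_int ((m + int (Suc n) * p) div q) < S (Suc n)"
        using phi_ge_div[of "m + int (Suc n) * p"] gap(1)[of "Suc n"] by linarith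
      moreover have "S (Suc n) \<le> of_int (k (Suc n)) + 1" using orb unfolding lifted_orbit_def by blast
      ultimately show ?thesis by linarith
    next
      case False
      then show ?thesis
        using gap_choice[OF orb gap[of "Suc n"]] div_eq_if_not_dvd[OF q_pos] by metis
    qed
    then show ?case using less by simp
  qed
  then show ?thesis by simp
qed

text \<open>The reflection of \<open>lower_forever\<close>: the gap above index \<open>m\<close>
  becomes the gap above \<open>- m - 2\<close>, and its upper end becomes the lower one.\<close>

lemma upper_forever:
  assumes orb: "lifted_orbit a b S k" and S0: "phi m < S 0" "S 0 < phi (m + 1)"
    and n0: "k n0 = (m + 1 + int n0 * p) div q" "q dvd m + 1 + int n0 * p"
    and "n0 \<le> n"
  shows "k n = (m + 1 + int n * p) div q"
proof -
  interpret dual: locked_rotation a "1 - a - b" "- p" q by (rule dual_locked)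
  have eq: "(- m - 2 + int n * - p) div q = - ((m + 1 + int n * p) div q) - 1" for n
    using neg_minus_1_div[OF q_pos, of "m + 1 + int n * p"] by (simp add: algebra_simps)
  have phi: "- m - 2 + 1 = - m - 1" "dual.phi (- m - 2) = - phi (m + 1)" "dual.phi (- m - 1) = - phi m"
    by (auto simp: phi_dual add.commute)
  have "q dvd - m - 2 + int n0 * - p + 1"
    using n0(2) dvd_minus_iff[of q "m + 1 + int n0 * p"] by (simp add: algebra_simps)
  then have "- k n - 1 = (- m - 2 + int n * - p) div q"
    using dual.lower_forever[OF lifted_orbit_dual[OF orb], of "- m - 2" n0 n] S0 n0 \<open>n0 \<le> n\<close>
    unfolding phi eq by simp
  then show ?thesis using eq[of n] by simp
qed

text \<open>Otherwise both an upper and a lower choice occur at times where they differ. Whichever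
  comes first rules out the other.\<close>

lemma gap_dichotomy:
  assumes orb: "lifted_orbit a b S k" and S0: "phi m < S 0" "S 0 < phi (m + 1)"
  shows "(\<forall>n. k n = (m + int n * p) div q) \<or> (\<forall>n. k n = (m + 1 + int n * p) div q)"
proof (rule ccontr)
  assume "\<not> ?thesis"
  then obtain n0 n1 where n: "k n0 \<noteq> (m + int n0 * p) div q" "k n1 \<noteq> (m + 1 + int n1 * p) div q"
    by blast
  have gap: "phi (m + int n * p) < S n" "S n < phi (m + int n * p + 1)" for n
    using gap_invariant[OF orb S0, of n] by (auto simp: algebra_simps)
  note choice = gap_choice[OF orb gap]
  have 0: "k n0 = (m + 1 + int n0 * p) div q" "q dvd m + 1 + int n0 * p"
    using choice[of n0] n(1) div_eq_if_not_dvd[OF q_pos, of "m + int n0 * p"]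
    by (auto simp: algebra_simps)
  have 1: "k n1 = (m + int n1 * p) div q" "q dvd m + int n1 * p + 1"
    using choice[of n1] n(2) div_eq_if_not_dvd[OF q_pos, of "m + int n1 * p"]
    by (auto simp: algebra_simps)
  show False
    using lower_forever[OF orb S0 1, of n0] upper_forever[OF orb S0 0, of n1] n by linarith
qed

end

section \<open>Orbits of the multi-valued map\<close>

lemma tendsto_divide_of_bounded_diff:
  fixes X :: "nat \<Rightarrow> real"
  assumes "Bseq (\<lambda>n. X n - of_nat n * r)"
  shows "(\<lambda>n. X n / of_nat n) \<longlonglongrightarrow> r"
proof -
  have "(\<lambda>n. (X n - of_nat n * r) * inverse (of_nat n)) \<longlonglongrightarrow> 0"
    using assms bounded_bilinear.Bfun_prod_Zfun[OF bounded_bilinear_mult] lim_inverse_n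
    by (auto simp: tendsto_Zfun_iff)
  then have "(\<lambda>n. (X n - of_nat n * r) * inverse (of_nat n) + r) \<longlonglongrightarrow> 0 + r"
    by (intro tendsto_add tendsto_const)
  moreover have "eventually (\<lambda>n. (X n - of_nat n * r) * inverse (of_nat n) + r = X n / of_nat n) sequentially"
    using eventually_gt_at_top[of "0::nat"] by eventually_elim (simp add: field_simps)
  ultimately show ?thesis
    by (auto elim: Lim_transform_eventually)
qed

text \<open>This form treats both branches at once: the images are the representatives of
  \<open>a x + b\<close> modulo 1 in the closed unit interval, where 0 and 1 are identified.\<close>

lemma f_pm_iff: "z \<in> f_pm a b x \<longleftrightarrow> 0 \<le> z \<and> z \<le> 1 \<and> (\<exists>e::int. z = a * x + b - of_int e)"
proof
  assume "z \<in> f_pm a b x"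
  then consider "z = frac (a * x + b)" | "z = 1 - frac (- (a * x + b))"
    by (auto simp: f_pm_def f_minus_def f_plus_def frac_plus_def)
  then show "0 \<le> z \<and> z \<le> 1 \<and> (\<exists>e::int. z = a * x + b - of_int e)"
  proof cases
    case 1
    then show ?thesis
      using frac_lt_1[of "a * x + b"] by (auto simp: frac_def intro: less_imp_le)
  next
    case 2
    then have "z = a * x + b - of_int (- \<lfloor>- (a * x + b)\<rfloor> - 1)"
      by (simp add: frac_def)
    moreover have "0 \<le> z" "z \<le> 1"
      using 2 frac_lt_1[of "- (a * x + b)"] frac_ge_0[of "- (a * x + b)"] by linarith+
    ultimately show ?thesis by blast
  qed
next
  assume z: "0 \<le> z \<and> z \<le> 1 \<and> (\<exists>e::int. z = a * x + b - of_int e)"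
  then obtain e :: int where e: "z = a * x + b - of_int e" by blast
  show "z \<in> f_pm a b x"
  proof (cases "z < 1")
    case True
    then have "frac (a * x + b) = z"
      using z e by (subst frac_unique_iff) auto
    then show ?thesis by (simp add: f_pm_def f_minus_def)
  next
    case False
    then have "- (a * x + b) = of_int (- e - 1)" using z e by simp
    then have "frac (- (a * x + b)) = 0" by (simp only: frac_eq_0_iff Ints_of_int)
    then show ?thesis
      using z False by (simp add: f_pm_def f_plus_def frac_plus_def)
  qed
qed

lemma f_plus_bounds: "0 < f_plus a b x" "f_plus a b x \<le> 1"
  using frac_lt_1[of "- (a * x + b)"] by (auto simp: f_plus_def frac_plus_def)

lemma f_pm_eq_f_minus:
  assumes "z \<in> f_pm a b x" "z < 1"
  shows "z = f_minus a b x"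
proof -
  obtain e :: int where "z = a * x + b - of_int e" "0 \<le> z"
    using assms f_pm_iff by blast
  then show ?thesis
    using assms(2) frac_unique_iff[of "a * x + b" z] by (simp add: f_minus_def)
qed

lemma f_pm_eq_f_plus:
  assumes "z \<in> f_pm a b x" "0 < z"
  shows "z = f_plus a b x"
proof -
  obtain e :: int where e: "z = a * x + b - of_int e" "z \<le> 1"
    using assms f_pm_iff by blast
  then have "frac (- (a * x + b)) = 1 - z"
    using assms(2) by (subst frac_unique_iff) auto
  then show ?thesis
    by (simp add: f_plus_def frac_plus_def)
qed

lemma f_pm_subset_unit: "z \<in> f_pm a b x \<Longrightarrow> z \<in> {0..1}"
  by (simp add: f_pm_iff)

lemma orbits_in_unit: "s \<in> orbits (f_pm a b) x \<Longrightarrow> s n \<in> {0..1}"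
  using f_pm_subset_unit[of "s n" a b "s (n - 1)"] by (cases n) (simp_all add: orbits_def)

lemma orbits_shift: "s \<in> orbits (f_pm a b) x \<Longrightarrow> (\<lambda>n. s (n + i)) \<in> orbits (f_pm a b) (s i)"
  using orbits_in_unit[of s a b x i] by (simp add: orbits_def)

lemma orbits_mono: "s \<in> orbits g x \<Longrightarrow> (\<And>x. g x \<subseteq> h x) \<Longrightarrow> s \<in> orbits h x"
  by (auto simp: orbits_def)

lemma orbits_lift:
  assumes "s \<in> orbits (f_pm a b) x"
  obtains k where "lifted_orbit a b (\<lambda>n. s n + of_int (k n)) k" "k 0 = 0"
proof -
  have "\<exists>e::int. s (Suc n) = a * s n + b - of_int e" for n
    using assms by (auto simp: orbits_def f_pm_iff)
  then obtain e :: "nat \<Rightarrow> int" where e: "\<And>n. s (Suc n) = a * s n + b - of_int (e n)"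
    by metis
  \<comment> \<open>\<open>k n\<close> is the total of the integers subtracted in the first
    \<open>n\<close> steps; it is at once the shift of the lift and its itinerary.\<close>
  define k where "k n = (\<Sum>i<n. e i)" for n
  show ?thesis
  proof (rule that[of k])
    show "lifted_orbit a b (\<lambda>n. s n + of_int (k n)) k"
      using orbits_in_unit[OF assms] by (auto simp: lifted_orbit_def e k_def algebra_simps)
  qed (simp add: k_def)
qed

lemma ex_orbit:
  assumes "\<And>x. g x \<noteq> {}" "x \<in> {0..1}"
  obtains s where "s \<in> orbits g x"
proof -
  define s where "s = rec_nat x (\<lambda>_ z. SOME w. w \<in> g z)"
  have "s (Suc n) \<in> g (s n)" for n
    using assms(1) by (simp add: s_def some_in_eq)
  then show ?thesis
    using assms(2) by (intro that[of s]) (auto simp: orbits_def s_def)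
qed

lemma set_image_mono: "K \<subseteq> L \<Longrightarrow> set_image g K \<subseteq> set_image g L"
  by (auto simp: set_image_def)

lemma subset_invariant_set:
  assumes "D \<subseteq> {0..1}" "D \<subseteq> set_image g D"
  shows "D \<subseteq> invariant_set g"
proof -
  have "D \<subseteq> (set_image g ^^ n) {0..1}" for n
  proof (induction n)
    case (Suc n)
    then show ?case using assms(2) set_image_mono[OF Suc, of g] by auto
  qed (use assms in simp)
  then show ?thesis by (auto simp: invariant_set_def)
qed

text \<open>Membership in the \<open>n\<close>-th image gives a finite backward path; any orbit of
  \<open>x\<close> prolongs it to an infinite one.\<close>

lemma ex_orbit_reaching:
  assumes "\<And>x. g x \<noteq> {}" "\<And>x. g x \<subseteq> {0..1}" "x \<in> invariant_set g"
  obtains s where "s \<in> orbits g (s 0)" "s n = x"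
proof -
  have "x \<in> (set_image g ^^ n) {0..1}"
    using assms(3) by (auto simp: invariant_set_def)
  then have "\<exists>s. s \<in> orbits g (s 0) \<and> s n = x"
  proof (induction n arbitrary: x)
    case 0
    then obtain s where "s \<in> orbits g x" using ex_orbit assms(1) by auto
    then show ?case by (auto simp: orbits_def)
  next
    case (Suc n)
    then obtain z where z: "z \<in> (set_image g ^^ n) {0..1}" "x \<in> g z"
      unfolding set_image_def funpow.simps o_apply by blast
    then obtain s where s: "s \<in> orbits g (s 0)" "s n = z" using Suc by blast
    obtain t where t: "t \<in> orbits g x" using ex_orbit assms(1,2) z(2) by blast
    define u where "u i = (if i \<le> n then s i else t (i - Suc n))" for i
    have "u (Suc i) \<in> g (u i)" for i
    proof -
      consider "i < n" | "i = n" | "n < i" by linarith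
      then show ?thesis
      proof cases
        case 3
        then have "i - n = Suc (i - Suc n)" by simp
        then show ?thesis using 3 t by (auto simp: u_def orbits_def)
      qed (use s t z in \<open>auto simp: u_def orbits_def\<close>)
    qed
    then have "u \<in> orbits g (u 0)" "u (Suc n) = x"
      using s t by (auto simp: orbits_def u_def)
    then show ?case by blast
  qed
  then show ?thesis using that by blast
qed

section \<open>Convergence of lifted orbits and the rotation number\<close>

context locked_rotation begin

text \<open>The dichotomy fixes one end of the gap for all times. The initial distance is at most 1,
  since a gap is no longer than \<open>phi (m + q) - phi m\<close>.\<close>

lemma off_range_close:
  assumes orb: "lifted_orbit a b S k" and "S 0 \<notin> range phi"
  shows "\<exists>m. \<forall>n. k n = (m + int n * p) div q \<and> \<bar>S n - phi (m + int n * p)\<bar> \<le> a ^ n"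
proof -
  obtain m0 where m0: "phi m0 \<le> S 0" "S 0 < phi (m0 + 1)" by (rule phi_bracket)
  then have "phi m0 < S 0" using assms(2) by (metis less_le rangeI)
  have "phi (m0 + 1) \<le> phi m0 + 1"
    using phi_add_q[of m0] phi_le_iff[of "m0 + 1" "m0 + q"] q_pos by simp
  have "\<exists>m. (\<forall>n. k n = (m + int n * p) div q) \<and> \<bar>S 0 - phi m\<bar> \<le> 1"
    using gap_dichotomy[OF orb \<open>phi m0 < S 0\<close> m0(2)]
  proof
    assume "\<forall>n. k n = (m0 + int n * p) div q"
    then show ?thesis using m0 \<open>phi (m0 + 1) \<le> phi m0 + 1\<close> by (intro exI[of _ m0]) auto
  next
    assume "\<forall>n. k n = (m0 + 1 + int n * p) div q"
    then show ?thesis using m0 \<open>phi (m0 + 1) \<le> phi m0 + 1\<close> by (intro exI[of _ "m0 + 1"]) auto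
  qed
  then obtain m where k: "\<And>n. k n = (m + int n * p) div q" and m: "\<bar>S 0 - phi m\<bar> \<le> 1"
    by blast
  have "\<bar>S n - phi (m + int n * p)\<bar> \<le> a ^ n" for n
    unfolding lifted_orbit_affine[OF orb k] using a_pos m by (simp add: abs_mult mult_left_le)
  then show ?thesis using k by blast
qed

text \<open>By \<open>lift_backward\<close>, a step into \<open>range phi\<close> must use the digit
  of the index it starts from.\<close>

lemma lifted_orbit_leaves_range:
  assumes orb: "lifted_orbit a b S k" and "S n = phi i" "k n \<noteq> i div q"
  shows "S (Suc n) \<notin> range phi"
proof
  assume "S (Suc n) \<in> range phi"
  then obtain i' where "S (Suc n) = phi (i' - p + p)" by auto
  then have "S n = phi (i' - p) \<and> k n = (i' - p) div q"
    using orb by (intro lift_backward) (auto simp: lifted_orbit_def)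
  then show False using assms(2,3) by (auto simp: phi_inj)
qed

text \<open>A lifted orbit that starts in \<open>range phi\<close> either follows \<open>phi\<close>
  forever or leaves the range with its first deviating digit; then \<open>off_range_close\<close>
  applies.\<close>

lemma lifted_orbit_eventually:
  assumes orb: "lifted_orbit a b S k"
  shows "\<exists>m N. \<forall>n\<ge>N. k n = (m + int n * p) div q \<and> \<bar>S n - phi (m + int n * p)\<bar> \<le> a ^ (n - N)"
proof -
  have off: ?thesis if "S N \<notin> range phi" for N
  proof -
    obtain m where m: "\<And>n. k (n + N) = (m + int n * p) div q \<and> \<bar>S (n + N) - phi (m + int n * p)\<bar> \<le> a ^ n"
      using off_range_close[OF lifted_orbit_shift[OF orb, of N]] \<open>S N \<notin> range phi\<close>
      unfolding add_0 by blast
    show ?thesis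
    proof (intro exI allI impI)
      fix n assume "N \<le> n"
      \<comment> \<open>Subtracting \<open>N p\<close> from the index moves the reference time from
        \<open>N\<close> to 0.\<close>
      then show "k n = (m - int N * p + int n * p) div q \<and>
          \<bar>S n - phi (m - int N * p + int n * p)\<bar> \<le> a ^ (n - N)"
        using m[of "n - N"] by (simp add: of_nat_diff algebra_simps)
    qed
  qed
  show ?thesis
  proof (cases "S 0 \<in> range phi")
    case True
    then obtain m where m: "S 0 = phi m" by auto
    show ?thesis
    proof (cases "\<forall>n. k n = (m + int n * p) div q")
      case True
      then have k: "k n = (m + int n * p) div q" for n by blast
      have "\<bar>S n - phi (m + int n * p)\<bar> \<le> a ^ (n - 0)" for n
        unfolding lifted_orbit_affine[OF orb k] using m a_pos by simp
      then show ?thesis using k by blast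
    next
      case False
      define n where "n = (LEAST n. k n \<noteq> (m + int n * p) div q)"
      have n: "k n \<noteq> (m + int n * p) div q"
        unfolding n_def by (rule LeastI_ex[of "\<lambda>n. k n \<noteq> (m + int n * p) div q"]) (use False in blast)
      have "S i = phi (m + int i * p)" if "i \<le> n" for i
        using that
      proof (induction i)
        case (Suc i)
        then have "k i = (m + int i * p) div q"
          using not_less_Least[of i "\<lambda>n. k n \<noteq> (m + int n * p) div q"] unfolding n_def by auto
        moreover have "S (Suc i) = a * S i + b + (1 - a) * of_int (k i)"
          using orb by (simp add: lifted_orbit_def)
        ultimately show ?case
          using Suc phi_step[of "m + int i * p"] by (simp add: algebra_simps)
      qed (use m in simp)
      then show ?thesis
        using off[of "Suc n"] lifted_orbit_leaves_range[OF orb _ n] by simp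
    qed
  qed (rule off)
qed

lemma phi_rotation_bound: "\<bar>phi m - of_int m / of_int q\<bar> \<le> 1"
proof -
  have "of_int (m div q) \<le> real_of_int m / of_int q" "real_of_int m / of_int q \<le> of_int (m div q) + 1"
    using q_pos floor_divide_of_int_eq[of m q, where 'a = real] by linarith+
  then show ?thesis using phi_ge_div[of m] phi_le_div[of m] by linarith
qed

lemma lifted_orbit_rotation:
  assumes orb: "lifted_orbit a b S k"
  shows "(\<lambda>n. S n / of_nat n) \<longlonglongrightarrow> of_int p / of_int q"
proof (rule tendsto_divide_of_bounded_diff)
  obtain m N where m: "\<And>n. n \<ge> N \<Longrightarrow> \<bar>S n - phi (m + int n * p)\<bar> \<le> a ^ (n - N)"
    using lifted_orbit_eventually[OF orb] by blast
  have "\<bar>S n - of_nat n * (of_int p / of_int q)\<bar> \<le> 2 + \<bar>of_int m / of_int q\<bar>" if "n \<ge> N" for n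
  proof -
    have "a ^ (n - N) \<le> 1" using a_pos a_less_1 by (simp add: power_le_one)
    moreover have "of_int (m + int n * p) / of_int q = of_int m / of_int q + of_nat n * (of_int p / real_of_int q)"
      by (simp add: add_divide_distrib)
    ultimately show ?thesis
      using m[OF that] phi_rotation_bound[of "m + int n * p"] unfolding abs_le_iff by linarith
  qed
  then show "Bseq (\<lambda>n. S n - of_nat n * (of_int p / of_int q))"
    by (intro BfunI[of _ "2 + \<bar>of_int m / of_int q\<bar>"] eventually_sequentiallyI[of N]) auto
qed

section \<open>The periodic orbit and convergence to it\<close>

definition cycle :: "nat \<Rightarrow> real" where "cycle n = phi ((int n * p) mod q)"

definition C :: "real set" where "C = phi ` {0..<q}"

lemma C_subset_unit: "C \<subseteq> {0..1}"
proof
  fix c assume "c \<in> C"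
  then obtain i where "c = phi i" "i div q = 0" by (auto simp: C_def)
  then show "c \<in> {0..1}" using phi_ge_div[of i] phi_le_div[of i] by simp
qed

lemma phi_mod_in_C: "phi (m mod q) \<in> C"
  using pos_mod_bound[OF q_pos] pos_mod_sign[OF q_pos] by (auto simp: C_def)

lemma phi_in_C: "i div q = 0 \<Longrightarrow> phi i \<in> C"
  using phi_mod_in_C[of i] mult_div_mod_eq[of q i] by simp

lemma cycle_in_C: "cycle n \<in> C"
  by (simp add: cycle_def phi_mod_in_C)

lemma cycle_period: "cycle (n + nat q) = cycle n"
  using q_pos by (simp add: cycle_def algebra_simps)

lemma C_eq_cycle: "C = cycle ` {..<nat q}"
proof
  show "C \<subseteq> cycle ` {..<nat q}"
  proof
    fix c assume "c \<in> C"
    then obtain i where i: "c = phi i" "0 \<le> i" "i < q" by (auto simp: C_def)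
    obtain n where n: "int n < q" "q dvd - i + int n * p" using ex_dvd_add_mult by blast
    then have "(int n * p) mod q = i mod q"
      by (simp add: mod_eq_dvd_iff)
    then have "cycle n = c" using i by (simp add: cycle_def)
    then show "c \<in> cycle ` {..<nat q}" using n by auto
  qed
qed (auto simp: cycle_in_C)

lemma C_eq_range_cycle: "C = range cycle"
  using C_eq_cycle cycle_in_C by auto

lemma cycle_step: "cycle (Suc n) \<in> f_pm a b (cycle n)"
proof -
  let ?i = "(int n * p) mod q"
  have "(?i + p) mod q = (int (Suc n) * p) mod q"
    by (simp add: mod_simps algebra_simps)
  moreover have "?i div q = 0" using pos_mod_bound[OF q_pos] pos_mod_sign[OF q_pos] by simp
  ultimately have step: "cycle (Suc n) = a * cycle n + b - of_int ((?i + p) div q)"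
    using phi_step[of ?i] phi_mod[of "?i + p"] by (simp add: cycle_def)
  have "cycle (Suc n) \<in> {0..1}"
    using C_subset_unit cycle_in_C[of "Suc n"] by blast
  then show ?thesis
    unfolding f_pm_iff by (intro conjI exI[of _ "(?i + p) div q"] step) simp_all
qed

text \<open>The integer \<open>e\<close> is absorbed into the index as \<open>e * q\<close>, after
  which this is \<open>lift_backward\<close> with digit 0.\<close>

lemma f_pm_into_C:
  assumes "z \<in> f_pm a b x" "z \<in> C" "x \<in> {0..1}"
  shows "x \<in> C"
proof -
  obtain e :: int where e: "z = a * x + b - of_int e" using assms(1) f_pm_iff by blast
  obtain i where "z = phi i" using assms(2) by (auto simp: C_def)
  then have "a * x + b + (1 - a) * of_int 0 = phi (i + e * q - p + p)"
    using e by (simp add: phi_add_mult)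
  then have "x = phi (i + e * q - p) \<and> 0 = (i + e * q - p) div q"
    using assms(3) by (intro lift_backward) auto
  then show ?thesis
    using phi_in_C[of "i + e * q - p"] by simp
qed

lemma orbit_stays_off_C:
  assumes "s \<in> orbits (f_pm a b) x" "s i \<notin> C" "i \<le> n"
  shows "s n \<notin> C"
  using assms(3)
proof (induction n rule: dec_induct)
  case (step n)
  moreover have "s (Suc n) \<in> f_pm a b (s n)"
    using assms(1) by (simp add: orbits_def)
  ultimately show ?case
    using f_pm_into_C[of "s (Suc n)" "s n"] orbits_in_unit[OF assms(1), of n] by blast
qed (rule assms)

lemma orbit_off_C_close:
  assumes s: "s \<in> orbits (f_pm a b) x" and "s i \<notin> C"
  shows "\<exists>c\<in>C. \<bar>s (i + Suc n) - c\<bar> \<le> a ^ n"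
proof -
  have t: "(\<lambda>n. s (n + i)) \<in> orbits (f_pm a b) (s i)" by (rule orbits_shift[OF s])
  obtain k where k: "lifted_orbit a b (\<lambda>n. s (n + i) + of_int (k n)) k" "k 0 = 0"
    by (rule orbits_lift[OF t])
  \<comment> \<open>One step is spent here because a point off \<open>C\<close> can lie in
    \<open>range phi\<close>: if \<open>phi 0 = 0\<close>, then \<open>phi q = 1\<close> is such a
    point. After the step \<open>lift_backward\<close> excludes this.\<close>
  have "s (Suc 0 + i) + of_int (k (Suc 0)) \<notin> range phi"
  proof
    assume "s (Suc 0 + i) + of_int (k (Suc 0)) \<in> range phi"
    then obtain j where "s (Suc 0 + i) + of_int (k (Suc 0)) = phi (j - p + p)" by auto
    then have "s i = phi (j - p) \<and> 0 = (j - p) div q"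
      using k(1)[unfolded lifted_orbit_def, rule_format, of 0] k(2) by (intro lift_backward) auto
    then show False using phi_in_C[of "j - p"] assms(2) by simp
  qed
  then obtain m where m: "\<And>n. k (n + Suc 0) = (m + int n * p) div q \<and>
      \<bar>s (n + Suc 0 + i) + of_int (k (n + Suc 0)) - phi (m + int n * p)\<bar> \<le> a ^ n"
    using off_range_close[OF lifted_orbit_shift[OF k(1), of "Suc 0"]] by auto
  have "\<bar>s (i + Suc n) - phi ((m + int n * p) mod q)\<bar> \<le> a ^ n"
    using conjunct2[OF m[of n]] unfolding conjunct1[OF m[of n]] phi_mod[of "m + int n * p"]
    by (simp add: add.commute[of i])
  then show ?thesis using phi_mod_in_C by blast
qed

lemma orbit_tendsto_cycle:
  assumes s: "s \<in> orbits (f_pm a b) x"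
  obtains j where "(\<lambda>n. s n - cycle (j + n)) \<longlonglongrightarrow> 0"
proof -
  obtain k where k: "lifted_orbit a b (\<lambda>n. s n + of_int (k n)) k"
    by (rule orbits_lift[OF s])
  obtain m N where m: "\<And>n. n \<ge> N \<Longrightarrow> k n = (m + int n * p) div q \<and>
      \<bar>s n + of_int (k n) - phi (m + int n * p)\<bar> \<le> a ^ (n - N)"
    using lifted_orbit_eventually[OF k] by blast
  \<comment> \<open>Choosing \<open>j p\<close> congruent to \<open>m\<close> modulo
    \<open>q\<close> puts the cycle in phase with the orbit.\<close>
  obtain j where j: "q dvd - m + int j * p" using ex_dvd_add_mult by blast
  have bound: "norm (s (n + N) - cycle (j + (n + N))) \<le> a ^ n" for n
  proof -
    have "(int (j + (n + N)) * p) mod q = (m + int (n + N) * p) mod q"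
      using j by (simp add: mod_eq_dvd_iff algebra_simps)
    then have "cycle (j + (n + N)) = phi ((m + int (n + N) * p) mod q)"
      by (simp only: cycle_def)
    moreover have "k (n + N) = (m + int (n + N) * p) div q"
      "\<bar>s (n + N) + of_int (k (n + N)) - phi (m + int (n + N) * p)\<bar> \<le> a ^ n"
      using m[of "n + N"] le_add2[of N n] unfolding add_diff_cancel_right' by blast+
    ultimately show ?thesis
      using phi_mod[of "m + int (n + N) * p"] by simp
  qed
  have "(\<lambda>n. s (n + N) - cycle (j + (n + N))) \<longlonglongrightarrow> 0"
    by (rule tendsto_0_le[where K = 1 and f = "\<lambda>n. a ^ n"])
      (use LIMSEQ_power_zero[of a] bound a_pos a_less_1 in auto)
  then show ?thesis using LIMSEQ_offset[of "\<lambda>n. s n - cycle (j + n)" N 0] that by blast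
qed

text \<open>The difference from a shifted cycle tends to 0 and has period \<open>k * nat q\<close>,
  so it vanishes.\<close>

lemma periodic_seq_eq_cycle:
  assumes "periodic_seq (f_pm a b) s k"
  obtains j where "\<And>n. s n = cycle (j + n)"
proof -
  have s: "s \<in> orbits (f_pm a b) (s 0)" "k \<ge> 1" "\<And>n. s (n + k) = s n"
    using assms by (auto simp: periodic_seq_def)
  obtain j where j: "(\<lambda>n. s n - cycle (j + n)) \<longlonglongrightarrow> 0" by (rule orbit_tendsto_cycle[OF s(1)])
  have "s (n + k * nat q) - cycle (j + (n + k * nat q)) = s n - cycle (j + n)" for n
    using periodic_mult[of s k n "nat q", OF s(3)]
      periodic_mult[of cycle "nat q" "j + n" k, OF cycle_period] by (simp add: algebra_simps)
  then have "s n - cycle (j + n) = 0" for n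
    using s(2) q_pos j by (intro periodic_tendsto_0[of "\<lambda>n. s n - cycle (j + n)" "k * nat q"]) auto
  then show ?thesis using that[of j] by simp
qed

lemma ex_cycle_shift: "\<exists>i. \<forall>n. cycle (j + i + n) = cycle (l + n)"
proof -
  \<comment> \<open>The index shift \<open>l - j\<close> may be negative; adding \<open>j\<close>
    full periods makes it a natural number.\<close>
  have "cycle (j + (l + j * (nat q - 1)) + n) = cycle (l + n)" for n
  proof -
    have "j + j * (nat q - 1) = j * nat q" using q_pos
      by (cases "nat q") auto
    then have "j + (l + j * (nat q - 1)) + n = l + n + j * nat q" by linarith
    then show ?thesis using periodic_mult[of cycle "nat q" "l + n" j, OF cycle_period] by (simp only:)
  qed
  then show ?thesis by blast
qed

lemma range_cycle_shift: "range (\<lambda>n. cycle (j + n)) = C"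
proof
  show "C \<subseteq> range (\<lambda>n. cycle (j + n))"
    unfolding C_eq_range_cycle
  proof
    fix c assume "c \<in> range cycle"
    then obtain l where "c = cycle (l + 0)" by auto
    moreover obtain i where "\<And>n. cycle (j + i + n) = cycle (l + n)" using ex_cycle_shift by blast
    ultimately have "c = cycle (j + i)" by (metis add.right_neutral)
    then show "c \<in> range (\<lambda>n. cycle (j + n))" by blast
  qed
qed (auto simp: cycle_in_C)

lemma periodic_orbit_eq_C:
  assumes "periodic_orbit (f_pm a b) D"
  shows "D = C"
proof -
  obtain s k where s: "periodic_seq (f_pm a b) s k" "D = s ` {..<k}"
    using assms by (auto simp: periodic_orbit_def)
  then have k: "k > 0" "\<And>n. s (n + k) = s n" by (auto simp: periodic_seq_def)
  have "s n \<in> D" for n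
    using periodic_mod[of s k n, OF k(2)] s(2) k(1) by (metis imageI lessThan_iff mod_less_divisor)
  then have "D = range s" using s(2) by auto
  also have "range s = C"
  proof -
    obtain j where "\<And>n. s n = cycle (j + n)" using periodic_seq_eq_cycle[OF s(1)] by blast
    then have "s = (\<lambda>n. cycle (j + n))" by blast
    then show ?thesis using range_cycle_shift[of j] by (simp only:)
  qed
  finally show ?thesis .
qed

lemma periodic_orbit_cycle:
  assumes "\<And>n. cycle (Suc n) \<in> g (cycle n)"
  shows "periodic_orbit g C"
proof -
  have "periodic_seq g cycle (nat q)"
    using assms C_subset_unit cycle_in_C[of 0] cycle_period q_pos
    by (auto simp: periodic_seq_def orbits_def)
  then show ?thesis using C_eq_cycle by (auto simp: periodic_orbit_def)
qed

lemma unique_periodic_orbit_C: "unique_periodic_orbit (f_pm a b) C"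
  unfolding unique_periodic_orbit_def
  using periodic_orbit_cycle[OF cycle_step] periodic_orbit_eq_C by blast

lemma orbit_converges:
  assumes "s \<in> orbits (f_pm a b) x"
  shows "converges_to_periodic_orbit (f_pm a b) s C"
proof -
  have "\<exists>j. (\<lambda>n. s n - y ((j + n) mod k)) \<longlonglongrightarrow> 0" if y: "periodic_seq (f_pm a b) y k" for y k
  proof -
    obtain l where l: "\<And>n. y n = cycle (l + n)" using periodic_seq_eq_cycle[OF y] by blast
    obtain j where j: "(\<lambda>n. s n - cycle (j + n)) \<longlonglongrightarrow> 0" by (rule orbit_tendsto_cycle[OF assms])
    obtain i where i: "\<And>n. cycle (l + i + n) = cycle (j + n)" using ex_cycle_shift by blast
    have "y ((i + n) mod k) = cycle (j + n)" for n
    proof -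
      have "y ((i + n) mod k) = y (i + n)"
        using y by (intro periodic_mod) (auto simp: periodic_seq_def)
      then show ?thesis using l[of "i + n"] i[of n] by (simp add: add.assoc)
    qed
    then have "(\<lambda>n. s n - y ((i + n) mod k)) \<longlonglongrightarrow> 0" using j by (simp only:)
    then show ?thesis ..
  qed
  moreover have "periodic_orbit (f_pm a b) C"
    by (rule periodic_orbit_cycle[OF cycle_step])
  ultimately show ?thesis
    by (simp add: converges_to_periodic_orbit_def)
qed

section \<open>Limit sets and invariant sets\<close>

lemma omega_limit_eq_C:
  assumes "\<And>x. g x \<subseteq> f_pm a b x" "\<And>x. g x \<noteq> {}" "x \<in> {0..1}"
  shows "omega_limit g x = C"
proof
  show "omega_limit g x \<subseteq> C"
  proof
    fix z assume "z \<in> omega_limit g x"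
    then obtain s r where s: "s \<in> orbits g x" "strict_mono r" "(s \<circ> r) \<longlonglongrightarrow> z"
      by (auto simp: omega_limit_def)
    have "s \<in> orbits (f_pm a b) x" by (rule orbits_mono[OF s(1)]) (rule assms(1))
    then obtain j where j: "(\<lambda>n. s n - cycle (j + n)) \<longlonglongrightarrow> 0" by (rule orbit_tendsto_cycle)
    have "(\<lambda>n. (s \<circ> r) n - cycle (j + r n)) \<longlonglongrightarrow> 0"
      using LIMSEQ_subseq_LIMSEQ[OF j s(2)] by (simp add: o_def)
    from tendsto_diff[OF s(3) this] have "(\<lambda>n. cycle (j + r n)) \<longlonglongrightarrow> z" by simp
    moreover have "closed C" unfolding C_def by (intro finite_imp_closed finite_imageI) simp
    ultimately show "z \<in> C" by (rule closed_sequentially[rotated 2]) (rule cycle_in_C)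
  qed
  show "C \<subseteq> omega_limit g x"
  proof
    fix c assume "c \<in> C"
    obtain s where s: "s \<in> orbits g x" by (rule ex_orbit[OF assms(2,3)])
    have "s \<in> orbits (f_pm a b) x" by (rule orbits_mono[OF s]) (rule assms(1))
    then obtain j where j: "(\<lambda>n. s n - cycle (j + n)) \<longlonglongrightarrow> 0" by (rule orbit_tendsto_cycle)
    obtain i where i: "c = cycle (j + i)"
      using \<open>c \<in> C\<close> unfolding range_cycle_shift[of j, symmetric] by blast
    define r where "r n = i + n * nat q" for n
    have r: "strict_mono r" using q_pos by (auto simp: r_def strict_mono_def)
    have "cycle (j + r n) = c" for n
      using periodic_mult[of cycle "nat q" "j + i" n, OF cycle_period] i
      by (simp add: r_def add.assoc)
    moreover have "(\<lambda>n. s (r n) - cycle (j + r n)) \<longlonglongrightarrow> 0"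
      using LIMSEQ_subseq_LIMSEQ[OF j r] by (simp add: o_def)
    ultimately have "(s \<circ> r) \<longlonglongrightarrow> c"
      by (simp add: LIM_zero_iff o_def)
    then show "c \<in> omega_limit g x" using s r unfolding omega_limit_def by blast
  qed
qed

text \<open>A point reached after arbitrarily many steps off \<open>C\<close> has distance 0 from
  the finite set \<open>C\<close>, so it lies in \<open>C\<close>, against the case
  \<open>n = 0\<close>. The fixed time \<open>i\<close> leaves room for orbits that start in
  \<open>C\<close> and leave it within \<open>i\<close> steps.\<close>

lemma not_reached_from_off_C:
  assumes "\<And>n. \<exists>s. s \<in> orbits (f_pm a b) (s 0) \<and> s i \<notin> C \<and> s (i + n) = x"
  shows False
proof -
  have "\<exists>c\<in>C. \<bar>x - c\<bar> \<le> a ^ n" for n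
    using assms[of "Suc n"] orbit_off_C_close by blast
  then obtain c where c: "\<And>n. c n \<in> C" "\<And>n. \<bar>x - c n\<bar> \<le> a ^ n" by metis
  have "(\<lambda>n. c n - x) \<longlonglongrightarrow> 0"
    by (rule tendsto_0_le[where K = 1 and f = "\<lambda>n. a ^ n"])
      (use LIMSEQ_power_zero[of a] c a_pos a_less_1 in \<open>auto simp: abs_minus_commute\<close>)
  then have "c \<longlonglongrightarrow> x" by (simp add: LIM_zero_iff)
  moreover have "closed C" unfolding C_def by (intro finite_imp_closed finite_imageI) simp
  ultimately have "x \<in> C" using closed_sequentially[of C c x] c(1) by blast
  then show False
    using assms[of 0] by auto
qed

text \<open>The third assumption makes \<open>C\<close> forward invariant under \<open>g\<close>, so
  orbits that reach a point off \<open>C\<close> start off \<open>C\<close>.\<close>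

lemma invariant_set_eq_C:
  assumes "\<And>x. g x \<subseteq> f_pm a b x" "\<And>x. g x \<noteq> {}" "\<And>n. g (cycle n) = {cycle (Suc n)}"
  shows "invariant_set g = C"
proof
  have fwd: "z \<in> C" if "x \<in> C" "z \<in> g x" for x z
    using that assms(3) cycle_in_C unfolding C_eq_range_cycle by auto
  have "c \<in> set_image g C" if "c \<in> C" for c
  proof -
    have "c \<in> range (\<lambda>n. cycle (1 + n))" unfolding range_cycle_shift by (rule that)
    then obtain n where "c = cycle (Suc n)" by auto
    then show ?thesis using assms(3)[of n] cycle_in_C[of n] by (auto simp: set_image_def)
  qed
  then show "C \<subseteq> invariant_set g" using C_subset_unit by (intro subset_invariant_set) auto
  show "invariant_set g \<subseteq> C"
  proof (rule ccontr)
    assume "\<not> invariant_set g \<subseteq> C"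
    then obtain x where x: "x \<in> invariant_set g" "x \<notin> C" by auto
    have "\<exists>s. s \<in> orbits (f_pm a b) (s 0) \<and> s 0 \<notin> C \<and> s (0 + n) = x" for n
    proof -
      have "g x \<subseteq> {0..1}" for x using assms(1) f_pm_subset_unit by blast
      then obtain s where s: "s \<in> orbits g (s 0)" "s n = x"
        using ex_orbit_reaching[of g x n] assms(2) x(1) by metis
      have "s (Suc i) \<in> g (s i)" for i using s(1) by (simp add: orbits_def)
      then have "s i \<in> C" if "s 0 \<in> C" for i
        using that by (induction i) (auto intro: fwd)
      then show ?thesis
        using s x(2) orbits_mono[OF s(1), of "f_pm a b"] assms(1) by (intro exI[of _ s]) auto
    qed
    then show False by (rule not_reached_from_off_C)
  qed
qed

end

lemma single_f_minus_subset: "single (f_minus a b) x \<subseteq> f_pm a b x"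
  by (simp add: single_def f_pm_def)

lemma single_f_plus_subset: "single (f_plus a b) x \<subseteq> f_pm a b x"
  by (simp add: single_def f_pm_def)

lemma f_pm_nonempty: "f_pm a b x \<noteq> {}"
  by (simp add: f_pm_def)

lemma single_nonempty: "single f x \<noteq> {}"
  by (simp add: single_def)

lemma zero_in_f_pm_iff: "0 \<in> f_pm a b x \<longleftrightarrow> 1 \<in> f_pm a b x"
proof
  assume "0 \<in> f_pm a b x"
  then obtain e :: int where "0 = a * x + b - of_int e" using f_pm_iff by blast
  then have "1 = a * x + b - of_int (e - 1)" by simp
  then show "1 \<in> f_pm a b x"
    unfolding f_pm_iff by (intro conjI exI[of _ "e - 1"]) simp_all
next
  assume "1 \<in> f_pm a b x"
  then obtain e :: int where "1 = a * x + b - of_int e" using f_pm_iff by blast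
  then have "0 = a * x + b - of_int (e + 1)" by simp
  then show "0 \<in> f_pm a b x"
    unfolding f_pm_iff by (intro conjI exI[of _ "e + 1"]) simp_all
qed

section \<open>The reflection\<close>

definition reflect :: "multimap \<Rightarrow> multimap" where
  "reflect g x = (\<lambda>z. 1 - z) ` g (1 - x)"

lemma orbits_reflect: "s \<in> orbits g x \<Longrightarrow> (\<lambda>n. 1 - s n) \<in> orbits (reflect g) (1 - x)"
  by (auto simp: orbits_def reflect_def)

lemma reflect_reflect: "reflect (reflect g) = g"
  by (rule ext) (simp add: reflect_def image_image)

lemma orbits_reflect_eq: "orbits (reflect g) x = (\<lambda>s n. 1 - s n) ` orbits g (1 - x)"
proof
  show "orbits (reflect g) x \<subseteq> (\<lambda>s n. 1 - s n) ` orbits g (1 - x)"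
  proof
    fix s assume "s \<in> orbits (reflect g) x"
    from orbits_reflect[OF this] have "(\<lambda>n. 1 - s n) \<in> orbits g (1 - x)"
      by (simp add: reflect_reflect)
    then show "s \<in> (\<lambda>s n. 1 - s n) ` orbits g (1 - x)"
      by (rule rev_image_eqI) simp
  qed
  show "(\<lambda>s n. 1 - s n) ` orbits g (1 - x) \<subseteq> orbits (reflect g) x"
    using orbits_reflect[of _ g "1 - x"] by auto
qed

lemma periodic_orbit_reflect:
  assumes "periodic_orbit g D"
  shows "periodic_orbit (reflect g) ((\<lambda>z. 1 - z) ` D)"
proof -
  obtain y k where y: "y \<in> orbits g (y 0)" "k \<ge> 1" "\<And>n. y (n + k) = y n" "D = y ` {..<k}"
    using assms by (auto simp: periodic_orbit_def periodic_seq_def)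
  then have "periodic_seq (reflect g) (\<lambda>n. 1 - y n) k"
    using orbits_reflect[OF y(1)] by (simp add: periodic_seq_def)
  moreover have "(\<lambda>z. 1 - z) ` D = (\<lambda>n. 1 - y n) ` {..<k}"
    by (simp add: y(4) image_image)
  ultimately show ?thesis unfolding periodic_orbit_def by blast
qed

lemma invariant_set_reflect: "invariant_set (reflect g) = (\<lambda>z. 1 - z) ` invariant_set g"
proof -
  have *: "set_image (reflect g) K = (\<lambda>z. 1 - z) ` set_image g ((\<lambda>z. 1 - z) ` K)" for K
    by (auto simp: set_image_def reflect_def)
  have "(set_image (reflect g) ^^ n) {0..1} = (\<lambda>z. 1 - z) ` (set_image g ^^ n) {0..1}" for n
  proof (induction n)
    case 0
    have "x \<in> (\<lambda>z. 1 - z) ` {0..1}" if "x \<in> {0..1}" for x :: real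
      using that by (intro image_eqI[of _ _ "1 - x"]) auto
    then show ?case by auto
  next
    case (Suc n)
    then show ?case by (simp add: * image_image)
  qed
  then show ?thesis
    unfolding invariant_set_def by (simp add: image_INT[of _ UNIV] inj_on_def)
qed

lemma f_plus_dual: "1 - f_minus a (1 - a - b) (1 - x) = f_plus a b x"
proof -
  have "a * (1 - x) + (1 - a - b) = - (a * x + b) + 1" by (simp add: algebra_simps)
  then show ?thesis
    by (simp only: f_minus_def f_plus_def frac_plus_def frac_1_eq)
qed

lemma f_minus_dual: "1 - f_plus a (1 - a - b) (1 - x) = f_minus a b x"
  using f_plus_dual[of a "1 - a - b" "1 - x"] by simp

lemma reflect_f_minus: "reflect (single (f_minus a (1 - a - b))) = single (f_plus a b)"
  by (rule ext) (simp add: reflect_def single_def f_plus_dual)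

lemma reflect_f_plus: "reflect (single (f_plus a (1 - a - b))) = single (f_minus a b)"
  by (rule ext) (simp add: reflect_def single_def f_minus_dual)

lemma reflect_f_pm: "reflect (f_pm a (1 - a - b)) = f_pm a b"
  by (rule ext) (simp add: reflect_def f_pm_def f_plus_dual f_minus_dual insert_commute)

section \<open>Iterates of the two lifts\<close>

lemma lifted_orbit_lift_minus:
  "lifted_orbit a b (\<lambda>n. (lift_minus a b ^^ n) x) (\<lambda>n. \<lfloor>(lift_minus a b ^^ n) x\<rfloor>)"
  using real_of_int_floor_add_one_ge by (auto simp: lifted_orbit_def lift_minus_def)

lemma lift_plus_dual: "lift_plus a b x = - lift_minus a (1 - a - b) (- x)"
proof -
  have "\<lfloor>1 - x\<rfloor> = \<lfloor>- x\<rfloor> + 1" using floor_add_int[of "- x" 1] by simp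
  then show ?thesis by (simp add: lift_plus_def lift_minus_def algebra_simps)
qed

lemma lift_plus_iterate_dual: "(lift_plus a b ^^ n) x = - (lift_minus a (1 - a - b) ^^ n) (- x)"
  by (induction n) (simp_all add: lift_plus_dual)

lemma lifted_orbit_lift_plus:
  "\<exists>k. lifted_orbit a b (\<lambda>n. (lift_plus a b ^^ n) x) k"
  using lifted_orbit_dual[OF lifted_orbit_lift_minus[of a "1 - a - b" "- x"]]
  by (auto simp: lift_plus_iterate_dual)

lemma lift_minus_mono:
  assumes "0 < a" "a < 1" "x \<le> y"
  shows "lift_minus a b x \<le> lift_minus a b y"
proof -
  have "a * x \<le> a * y" "(1 - a) * of_int \<lfloor>x\<rfloor> \<le> (1 - a) * of_int \<lfloor>y\<rfloor>"
    using assms by (auto intro!: mult_left_mono floor_mono)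
  then show ?thesis by (simp add: lift_minus_def)
qed

text \<open>By monotonicity the earlier deficits do no harm, and the last step subtracts
  \<open>e\<close> once more.\<close>

lemma lift_minus_iterate_le_diff:
  assumes "0 < a" "a < 1" "0 \<le> e" "0 < n"
  shows "(lift_minus a (b - e) ^^ n) x \<le> (lift_minus a b ^^ n) x - e"
  using assms(4)
proof (induction n rule: nat_induct_non_zero)
  case 1
  then show ?case by (simp add: lift_minus_def)
next
  case (Suc n)
  have "(lift_minus a (b - e) ^^ n) x \<le> (lift_minus a b ^^ n) x"
    using Suc assms(3) by simp
  then have "lift_minus a b ((lift_minus a (b - e) ^^ n) x) \<le> lift_minus a b ((lift_minus a b ^^ n) x)"
    using assms by (intro lift_minus_mono)
  moreover have "(lift_minus a (b - e) ^^ Suc n) x = lift_minus a b ((lift_minus a (b - e) ^^ n) x) - e"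
    by (simp add: lift_minus_def[of a "b - e" "(lift_minus a (b - e) ^^ n) x"]
        lift_minus_def[of a b "(lift_minus a (b - e) ^^ n) x"])
  ultimately show ?case by simp
qed

lemma iterate_mult_le:
  fixes f :: "real \<Rightarrow> real"
  assumes "\<And>x. (f ^^ k) x \<le> x + c"
  shows "(f ^^ (n * k)) x \<le> x + of_nat n * c"
proof (induction n)
  case (Suc n)
  have "(f ^^ (Suc n * k)) x = (f ^^ k) ((f ^^ (n * k)) x)"
    by (simp add: funpow_add)
  also have "\<dots> \<le> x + of_nat (Suc n) * c"
    using assms[of "(f ^^ (n * k)) x"] Suc by (simp add: algebra_simps)
  finally show ?case .
qed simp

section \<open>The three cases\<close>

context locked_rotation begin

lemma zero_in_C_iff: "0 \<in> C \<longleftrightarrow> phi 0 = 0"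
proof
  assume "0 \<in> C"
  then obtain i where "phi i = 0" "0 \<le> i" by (auto simp: C_def)
  then show "phi 0 = 0" using phi_le_iff[of 0 i] phi_0_nonneg by simp
qed (use phi_in_C[of 0] in simp)

lemma one_in_C_iff: "1 \<in> C \<longleftrightarrow> phi (q - 1) = 1"
proof
  assume "1 \<in> C"
  then obtain i where "phi i = 1" "i \<le> q - 1" by (auto simp: C_def)
  then show "phi (q - 1) = 1" using phi_le_iff[of i "q - 1"] phi_q_le_1 by simp
qed (use phi_in_C[of "q - 1"] q_pos in simp)

lemma f_minus_cycle:
  assumes "1 \<notin> C"
  shows "f_minus a b (cycle n) = cycle (Suc n)"
proof -
  have "cycle (Suc n) \<noteq> 1" "cycle (Suc n) \<in> {0..1}"
    using assms cycle_in_C[of "Suc n"] C_subset_unit by auto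
  then show ?thesis
    using f_pm_eq_f_minus[OF cycle_step[of n]] by simp
qed

lemma f_plus_cycle:
  assumes "0 \<notin> C"
  shows "f_plus a b (cycle n) = cycle (Suc n)"
proof -
  have "cycle (Suc n) \<noteq> 0" "cycle (Suc n) \<in> {0..1}"
    using assms cycle_in_C[of "Suc n"] C_subset_unit by auto
  then show ?thesis
    using f_pm_eq_f_plus[OF cycle_step[of n]] by simp
qed

lemma invariant_set_f_minus: "1 \<notin> C \<Longrightarrow> invariant_set (single (f_minus a b)) = C"
  by (rule invariant_set_eq_C[OF single_f_minus_subset single_nonempty])
    (simp add: single_def f_minus_cycle)

lemma invariant_set_f_plus: "0 \<notin> C \<Longrightarrow> invariant_set (single (f_plus a b)) = C"
  by (rule invariant_set_eq_C[OF single_f_plus_subset single_nonempty])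
    (simp add: single_def f_plus_cycle)

lemma invariant_set_f_pm: "0 \<notin> C \<Longrightarrow> 1 \<notin> C \<Longrightarrow> invariant_set (f_pm a b) = C"
  by (rule invariant_set_eq_C[OF order.refl f_pm_nonempty])
    (simp add: f_pm_def f_plus_cycle f_minus_cycle)

lemma periodic_orbit_f_minus: "1 \<notin> C \<Longrightarrow> periodic_orbit (single (f_minus a b)) C"
  by (rule periodic_orbit_cycle) (simp add: single_def f_minus_cycle)

section \<open>The lower end point, where 0 lies on the periodic orbit\<close>

context
  assumes phi_0: "phi 0 = 0"
begin

lemma zero_in_C: "0 \<in> C"
  using phi_0 zero_in_C_iff by simp

lemma one_notin_C: "1 \<notin> C"
  using phi_0 one_in_C_iff phi_add_q[of "-1"] phi_less[of "-1" 0] by simp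

lemma not_periodic_orbit_f_plus: "\<not> periodic_orbit (single (f_plus a b)) D"
proof
  assume "periodic_orbit (single (f_plus a b)) D"
  then obtain y k where y: "periodic_seq (single (f_plus a b)) y k"
    by (auto simp: periodic_orbit_def)
  then have orb: "y \<in> orbits (single (f_plus a b)) (y 0)" by (simp add: periodic_seq_def)
  then have "y \<in> orbits (f_pm a b) (y 0)"
    by (rule orbits_mono) (rule single_f_plus_subset)
  then have "periodic_seq (f_pm a b) y k" using y by (simp add: periodic_seq_def)
  then obtain j where j: "\<And>n. y n = cycle (j + n)"
    using periodic_seq_eq_cycle by blast
  have "0 \<in> range (\<lambda>n. cycle (Suc j + n))"
    unfolding range_cycle_shift by (rule zero_in_C)
  then obtain n where "y (Suc n) = 0" using j by auto
  moreover have "y (Suc n) = f_plus a b (y n)" using orb by (simp add: orbits_def single_def)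
  ultimately show False using f_plus_bounds(1)[of a b "y n"] by simp
qed

text \<open>By backward invariance the orbit would lie in \<open>C\<close> up to time
  \<open>q\<close>. There it avoids 1, so it follows the cycle and visits 0 after at least one step,
  but \<open>f_plus\<close> has no value 0.\<close>

lemma f_plus_orbit_leaves_C:
  assumes "s \<in> orbits (single (f_plus a b)) x"
  shows "s (nat q) \<notin> C"
proof
  assume C: "s (nat q) \<in> C"
  have orb: "s \<in> orbits (f_pm a b) x"
    using assms by (rule orbits_mono) (rule single_f_plus_subset)
  have inC: "s i \<in> C" if "i \<le> nat q" for i
    using orbit_stays_off_C[OF orb _ that] C by blast
  have step: "s (Suc i) = f_plus a b (s i)" for i
    using assms by (simp add: orbits_def single_def)
  obtain l where l: "s 0 = cycle l" using inC[of 0] C_eq_range_cycle by auto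
  have cyc: "s i = cycle (l + i)" if "i \<le> nat q" for i
    using that
  proof (induction i)
    case (Suc i)
    have "s (Suc i) \<in> {0..1}" "s (Suc i) \<noteq> 1"
      using inC[OF Suc.prems] C_subset_unit one_notin_C by auto
    then have "s (Suc i) = f_minus a b (s i)"
      using f_pm_eq_f_minus[of "s (Suc i)" a b "s i"] orb by (simp add: orbits_def)
    then show ?case
      using Suc f_minus_cycle[OF one_notin_C] by simp
  qed (use l in simp)
  have "0 \<in> range (\<lambda>n. cycle (Suc l + n))"
    unfolding range_cycle_shift by (rule zero_in_C)
  then obtain n where "cycle (Suc l + n) = 0" by auto
  then have "cycle (Suc l + n mod nat q) = 0"
    using periodic_mod[of "\<lambda>n. cycle (Suc l + n)" "nat q" n] cycle_period[of "Suc l + _"]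
    by (simp add: add.assoc)
  moreover have "Suc (n mod nat q) \<le> nat q" using q_pos by (simp add: Suc_leI)
  ultimately have "s (Suc (n mod nat q)) = 0" using cyc by simp
  then show False
    using step[of "n mod nat q"] f_plus_bounds(1)[of a b "s (n mod nat q)"] by simp
qed

lemma invariant_set_f_plus_empty: "invariant_set (single (f_plus a b)) = {}"
proof (rule ccontr)
  assume "invariant_set (single (f_plus a b)) \<noteq> {}"
  then obtain x where x: "x \<in> invariant_set (single (f_plus a b))" by blast
  have "\<exists>s. s \<in> orbits (f_pm a b) (s 0) \<and> s (nat q) \<notin> C \<and> s (nat q + n) = x" for n
  proof -
    have unit: "single (f_plus a b) x \<subseteq> {0..1}" for x
      using f_plus_bounds[of a b x] by (simp add: single_def)
    obtain s where s: "s \<in> orbits (single (f_plus a b)) (s 0)" "s (nat q + n) = x"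
      by (rule ex_orbit_reaching[OF single_nonempty unit x])
    have "s \<in> orbits (f_pm a b) (s 0)"
      by (rule orbits_mono[OF s(1)]) (rule single_f_plus_subset)
    then show ?thesis using s f_plus_orbit_leaves_C[OF s(1)] by blast
  qed
  then show False by (rule not_reached_from_off_C)
qed

text \<open>The branches differ only at the values 0 and 1. A step to 1 could equally go to 0, which
  is in \<open>C\<close>, so it would start in \<open>C\<close>.\<close>

lemma orbit_off_C_f_minus:
  assumes s: "s \<in> orbits (f_pm a b) x" and "x \<notin> C"
  shows "s (Suc n) = f_minus a b (s n)"
proof -
  have off: "s i \<notin> C" for i
    using orbit_stays_off_C[OF s, of 0 i] s assms(2) by (simp add: orbits_def)
  have step: "s (Suc n) \<in> f_pm a b (s n)" using s by (simp add: orbits_def)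
  have "s (Suc n) \<noteq> 1"
  proof
    assume "s (Suc n) = 1"
    then have "0 \<in> f_pm a b (s n)" using step zero_in_f_pm_iff by simp
    then show False
      using f_pm_into_C[OF _ zero_in_C] orbits_in_unit[OF s] off by blast
  qed
  then show ?thesis
    using f_pm_eq_f_minus[OF step] orbits_in_unit[OF s, of "Suc n"] by simp
qed

lemma orbits_one:
  obtains s where "orbits (f_pm a b) 1 = {s}"
proof -
  obtain s where s: "s \<in> orbits (f_pm a b) 1"
    using ex_orbit[of "f_pm a b" 1, OF f_pm_nonempty] by auto
  have "t n = s n" if t: "t \<in> orbits (f_pm a b) 1" for t n
  proof (induction n)
    case 0
    then show ?case using s t by (simp add: orbits_def)
  next
    case (Suc n)
    then show ?case
      using orbit_off_C_f_minus[OF s one_notin_C] orbit_off_C_f_minus[OF t one_notin_C] by simp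
  qed
  then have "orbits (f_pm a b) 1 = {s}" using s by blast
  then show ?thesis by (rule that)
qed

text \<open>The predecessor of 0 on the cycle also maps to 1, so the orbit of 1 belongs to the
  invariant set. Conversely 1 is the sole exit from \<open>C\<close>, so an orbit that starts in
  \<open>C\<close> stays in \<open>C\<close> or follows \<open>s\<close> after leaving.\<close>

lemma invariant_set_f_pm_one:
  assumes s: "orbits (f_pm a b) 1 = {s}"
  shows "invariant_set (f_pm a b) = C \<union> range s"
proof
  have orb: "s \<in> orbits (f_pm a b) 1" using s by simp
  show "C \<union> range s \<subseteq> invariant_set (f_pm a b)"
  proof (rule subset_invariant_set)
    show "C \<union> range s \<subseteq> {0..1}" using C_subset_unit orbits_in_unit[OF orb] by blast
    have pred: "\<exists>c\<in>C. z \<in> f_pm a b c" if "z \<in> C" for z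
    proof -
      have "z \<in> range (\<lambda>n. cycle (1 + n))" unfolding range_cycle_shift by (rule that)
      then obtain n where "z = cycle (Suc n)" by auto
      then show ?thesis using cycle_step[of n] cycle_in_C by blast
    qed
    have "1 \<in> set_image (f_pm a b) C"
      using pred[OF zero_in_C] zero_in_f_pm_iff by (auto simp: set_image_def)
    then have "s n \<in> set_image (f_pm a b) (C \<union> range s)" for n
      using orb by (cases n) (auto simp: orbits_def set_image_def)
    then show "C \<union> range s \<subseteq> set_image (f_pm a b) (C \<union> range s)"
      using pred unfolding set_image_def by blast
  qed
  show "invariant_set (f_pm a b) \<subseteq> C \<union> range s"
  proof (rule ccontr)
    assume "\<not> invariant_set (f_pm a b) \<subseteq> C \<union> range s"
    then obtain x where x: "x \<in> invariant_set (f_pm a b)" "x \<notin> C" "x \<notin> range s" by auto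
    have "\<exists>t. t \<in> orbits (f_pm a b) (t 0) \<and> t 0 \<notin> C \<and> t (0 + n) = x" for n
    proof -
      have unit: "f_pm a b x \<subseteq> {0..1}" for x using f_pm_subset_unit by blast
      obtain t where t: "t \<in> orbits (f_pm a b) (t 0)" "t n = x"
        by (rule ex_orbit_reaching[OF f_pm_nonempty unit x(1)])
      have "t 0 \<notin> C"
      proof
        assume "t 0 \<in> C"
        define i where "i = (LEAST i. t i \<notin> C)"
        have "t n \<notin> C" using t x by simp
        then have i: "t i \<notin> C" "i \<le> n"
          unfolding i_def by (rule LeastI, rule Least_le)
        then obtain i' where i': "i = Suc i'" using \<open>t 0 \<in> C\<close> by (cases i) auto
        then have "t i' \<in> C" using not_less_Least[of i' "\<lambda>i. t i \<notin> C"] i_def by auto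
        then obtain l where l: "t i' = cycle l" using C_eq_range_cycle by auto
        have step: "t i \<in> f_pm a b (t i')" using t(1) by (simp add: orbits_def i')
        have "t i = 1"
        proof (rule ccontr)
          assume "t i \<noteq> 1"
          then have "t i = f_minus a b (t i')"
            using orbits_in_unit[OF t(1), of i] by (intro f_pm_eq_f_minus[OF step]) simp
          then have "t i = cycle (Suc l)" using l f_minus_cycle[OF one_notin_C] by simp
          then show False using i(1) cycle_in_C by simp
        qed
        then have "(\<lambda>n. t (n + i)) = s" using orbits_shift[OF t(1), of i] s by simp
        then have "s (n - i) = x" using t(2) i(2) by auto
        then show False using x(3) by blast
      qed
      then show ?thesis using t by auto
    qed
    then show False by (rule not_reached_from_off_C)
  qed
qed

text \<open>Now \<open>phi (i * q) = i\<close>, so no integer is interior to a gap.\<close>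

lemma floor_gap:
  assumes "phi m \<le> x" "x < phi (m + 1)"
  shows "\<lfloor>x\<rfloor> = m div q"
proof (rule floor_unique)
  show "of_int (m div q) \<le> x" using phi_ge_div[of m] assms(1) by simp
  have "m + 1 \<le> (m div q + 1) * q"
    using div_mult_mod_eq[of m q] pos_mod_bound[OF q_pos, of m] distrib_right[of "m div q" 1 q]
    by linarith
  then have "phi (m + 1) \<le> phi (0 + (m div q + 1) * q)"
    by (simp add: phi_le_iff)
  also have "\<dots> = of_int (m div q) + 1"
    using phi_0 by (simp only: phi_add_mult)
  finally show "x < of_int (m div q) + 1"
    using assms(2) by simp
qed

text \<open>By \<open>floor_gap\<close> the orbit always takes the lower digit, so its distance to
  the lower end shrinks, while that end advances by exactly \<open>p\<close> in \<open>q\<close>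
  steps.\<close>

lemma lift_minus_iterate_le: "(lift_minus a b ^^ nat q) x \<le> x + of_int p"
proof -
  define S where "S n = (lift_minus a b ^^ n) x" for n
  obtain m where m: "phi m \<le> x" "x < phi (m + 1)" by (rule phi_bracket)
  have gap: "phi (m + int n * p) \<le> S n \<and> S n < phi (m + int n * p + 1)" for n
  proof (induction n)
    case (Suc n)
    let ?j = "m + int n * p"
    have S: "S (Suc n) = a * S n + b + (1 - a) * of_int (?j div q)"
      using floor_gap[of ?j "S n"] Suc by (simp add: S_def lift_minus_def)
    have "?j div q \<le> (?j + 1) div q" using q_pos by (intro zdiv_mono1) auto
    then have "(1 - a) * real_of_int (?j div q) \<le> (1 - a) * of_int ((?j + 1) div q)"
      using a_less_1 by (intro mult_left_mono) auto
    moreover have "a * phi ?j \<le> a * S n" "a * S n < a * phi (?j + 1)"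
      using Suc a_pos by auto
    ultimately have "phi (?j + p) \<le> S (Suc n)" "S (Suc n) < phi (?j + 1 + p)"
      unfolding S phi_step by linarith+
    then show ?case by (simp add: algebra_simps)
  qed (use m in \<open>simp add: S_def\<close>)
  have "lifted_orbit a b S (\<lambda>n. \<lfloor>S n\<rfloor>)"
    unfolding S_def by (rule lifted_orbit_lift_minus)
  then have "S n - phi (m + int n * p) = a ^ n * (S 0 - phi m)" for n
    by (rule lifted_orbit_affine) (use gap floor_gap in auto)
  from this[of "nat q"] have "S (nat q) - phi (m + q * p) = a ^ nat q * (x - phi m)"
    using q_pos by (simp add: S_def)
  also have "\<dots> \<le> 1 * (x - phi m)"
    using a_pos a_less_1 m by (intro mult_right_mono power_le_one) auto
  finally show ?thesis
    using phi_add_mult[of m p] by (simp add: S_def mult.commute)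
qed

end

end

section \<open>Parameters outside the interval, and formulas for its end points\<close>

context rotation begin

text \<open>Raising \<open>b\<close> by \<open>e\<close> reaches \<open>b_-\<close>, where
  \<open>q\<close> steps gain at most \<open>p\<close>. With the smaller parameter they gain at most
  \<open>p - e\<close>, so a limit of the averages is at most \<open>(p - e) / q\<close>.\<close>

lemma lift_minus_not_rotation:
  assumes "phi 0 < 0"
  shows "\<not> (\<lambda>n. (lift_minus a b ^^ n) x / of_nat n) \<longlonglongrightarrow> of_int p / of_int q"
proof
  assume lim: "(\<lambda>n. (lift_minus a b ^^ n) x / of_nat n) \<longlonglongrightarrow> of_int p / of_int q"
  define e where "e = (1 - a) * - phi 0"
  have e: "0 < e" using assms a_less_1 unfolding e_def by (intro mult_pos_pos) auto
  interpret R: rotation a "b + e" p q by unfold_locales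
  have "(b + e) / (1 - a) = b / (1 - a) - phi 0"
    using a_less_1 by (simp add: e_def diff_divide_distrib)
  then have phi: "R.phi m = phi m - phi 0" for m
    unfolding phi_def[of m] R.phi_def by simp
  interpret R: locked_rotation a "b + e" p q
    using phi_less[of "- 1" 0] phi_add_q[of "- 1"] by unfold_locales (auto simp: phi)
  have "(lift_minus a b ^^ nat q) y \<le> y + (of_int p - e)" for y
    using R.lift_minus_iterate_le[of y] phi[of 0]
      lift_minus_iterate_le_diff[of a e "nat q" "b + e" y] a_pos a_less_1 e q_pos
    by simp
  then have bound: "(lift_minus a b ^^ (n * nat q)) x \<le> x + of_nat n * (of_int p - e)" for n
    by (rule iterate_mult_le)
  have Q: "real (nat q) = of_int q" using q_pos by simp
  have "strict_mono (\<lambda>n. n * nat q)" using q_pos by (simp add: strict_mono_def)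
  from LIMSEQ_subseq_LIMSEQ[OF lim this]
  have lim': "(\<lambda>n. (lift_minus a b ^^ (n * nat q)) x / (of_nat n * of_int q)) \<longlonglongrightarrow> of_int p / of_int q"
    by (simp add: o_def Q)
  have "(\<lambda>n. x / of_int q * inverse (of_nat n) + (of_int p - e) / of_int q)
      \<longlonglongrightarrow> x / of_int q * 0 + (of_int p - e) / of_int q"
    by (intro tendsto_intros lim_inverse_n)
  then have "of_int p / of_int q \<le> x / of_int q * 0 + (of_int p - e) / of_int q"
  proof (rule tendsto_le[OF sequentially_bot _ lim'])
    show "\<forall>\<^sub>F n in sequentially. (lift_minus a b ^^ (n * nat q)) x / (of_nat n * of_int q)
        \<le> x / of_int q * inverse (of_nat n) + (of_int p - e) / of_int q"
      using eventually_gt_at_top[of "0::nat"]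
    proof eventually_elim
      case (elim n)
      have "(lift_minus a b ^^ (n * nat q)) x / (of_nat n * of_int q)
          \<le> (x + of_nat n * (of_int p - e)) / (of_nat n * of_int q)"
        using bound[of n] q_pos by (intro divide_right_mono) auto
      also have "\<dots> = x / of_int q * inverse (of_nat n) + (of_int p - e) / of_int q"
        using elim q_pos by (simp add: field_simps)
      finally show ?case .
    qed
  qed
  then show False
    using e q_pos by (simp add: divide_le_cancel)
qed

lemma lift_plus_not_rotation:
  assumes "1 < phi (q - 1)"
  shows "\<not> (\<lambda>n. (lift_plus a b ^^ n) x / of_nat n) \<longlonglongrightarrow> of_int p / of_int q"
proof
  assume lim: "(\<lambda>n. (lift_plus a b ^^ n) x / of_nat n) \<longlonglongrightarrow> of_int p / of_int q"
  interpret dual: rotation a "1 - a - b" "- p" q by (rule phi_dual_rotation)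
  have "dual.phi 0 < 0"
    using assms phi_add_q[of "- 1"] by (simp add: phi_dual)
  then show False
    using dual.lift_minus_not_rotation[of "- x"] tendsto_minus[OF lim]
    by (simp add: lift_plus_iterate_dual)
qed

lemma phi_0_eq: "phi 0 = (b - b_minus a (of_int p / of_int q)) / (1 - a)"
proof -
  have eq: "(0 - (int j + 1) * p) div q = - \<lceil>(of_nat j + 1) * (of_int p / of_int q :: real)\<rceil>" for j
    using floor_divide_of_int_eq[of "- ((int j + 1) * p)" q, where 'a = real]
    by (simp add: ceiling_def)
  have "(\<Sum>j. a ^ j * real_of_int ((0 - (int j + 1) * p) div q))
      = - (\<Sum>j. a ^ j * of_int \<lceil>(of_nat j + 1) * (of_int p / of_int q :: real)\<rceil>)"
    using suminf_minus[OF summable_phi[of 0]] unfolding eq by simp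
  then show ?thesis
    using a_less_1 by (simp add: phi_def b_minus_def power2_eq_square diff_divide_distrib)
qed

lemma phi_q_eq: "phi (q - 1) = 1 + (b - b_plus a (of_int p / of_int q)) / (1 - a)"
proof -
  define u where "u j = a ^ j * real_of_int (((int j + 1) * p) div q)" for j
  have u: "u j = a ^ j * of_int \<lfloor>(of_nat j + 1) * (of_int p / of_int q :: real)\<rfloor>" for j
    using floor_divide_of_int_eq[of "(int j + 1) * p" q, where 'a = real] by (simp add: u_def)
  have "summable u"
    using summable_power_times_div[OF a_pos a_less_1 q_pos, of 0 "- p"] unfolding u_def by simp
  \<comment> \<open>The computation is done at index \<open>- 1\<close>, where the quotients become
    floors of \<open>(j + 1) p / q\<close>; \<open>phi_add_q\<close> then moves the result to
    \<open>q - 1\<close>.\<close>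
  have "(- 1 - (int j + 1) * p) div q = - (((int j + 1) * p) div q) - 1" for j
  proof -
    have "- 1 - (int j + 1) * p = - ((int j + 1) * p) - 1" by simp
    then show ?thesis by (simp only: neg_minus_1_div[OF q_pos])
  qed
  then have "(\<Sum>j. a ^ j * real_of_int ((- 1 - (int j + 1) * p) div q)) = (\<Sum>j. - u j - a ^ j)"
    unfolding u_def by (intro suminf_cong) (simp only:, simp add: algebra_simps)
  also have "\<dots> = - suminf u - 1 / (1 - a)"
    using a_pos a_less_1 \<open>summable u\<close>
    by (simp add: suminf_diff[symmetric] suminf_minus summable_minus suminf_geometric summable_geometric)
  finally have "phi (- 1) = b / (1 - a) + (1 - a) * (- suminf u - 1 / (1 - a))"
    by (simp add: phi_def)
  moreover have "(1 - a) * (- suminf u - 1 / (1 - a)) = - ((1 - a) * suminf u) - 1"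
    using a_less_1 by (simp add: right_diff_distrib)
  moreover have "(b - (1 - a + (1 - a)\<^sup>2 * suminf u)) / (1 - a) = b / (1 - a) - 1 - (1 - a) * suminf u"
    using a_less_1 by (simp add: diff_divide_distrib add_divide_distrib power2_eq_square)
  ultimately show ?thesis
    using phi_add_q[of "- 1"] unfolding b_plus_def u[symmetric] by simp
qed

end

section \<open>The upper end point, by reflection\<close>

lemma (in locked_rotation) phi_q_case:
  assumes "phi (q - 1) = 1"
  shows "1 \<in> C \<and> 0 \<notin> C \<and>
    periodic_orbit (single (f_plus a b)) C \<and>
    \<not> (\<exists>D. periodic_orbit (single (f_minus a b)) D) \<and>
    invariant_set (single (f_plus a b)) = C \<and>
    invariant_set (single (f_minus a b)) = {} \<and>
    (\<exists>s. orbits (f_pm a b) 0 = {s} \<and> invariant_set (f_pm a b) = C \<union> range s)"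
proof -
  let ?h = "\<lambda>z::real. 1 - z"
  interpret dual: locked_rotation a "1 - a - b" "- p" q by (rule dual_locked)
  have phi: "dual.phi 0 = 0"
    using assms phi_add_q[of "- 1"] by (simp add: phi_dual)
  have hh: "?h ` ?h ` A = A" for A by (simp add: image_image)
  \<comment> \<open>Reversing the order of the indices below \<open>q\<close> shows that the
    periodic orbit of the reflected system is the mirror image of \<open>C\<close>.\<close>
  have "dual.phi i = 1 - phi (q - 1 - i)" for i
  proof -
    have "q - 1 - i = - i - 1 + q" by simp
    then show ?thesis by (simp only: phi_dual phi_add_q)
  qed
  then have "dual.C = (\<lambda>i. 1 - phi (q - 1 - i)) ` {0..<q}"
    unfolding dual.C_def by simp
  also have "\<dots> = ?h ` phi ` (\<lambda>i. q - 1 - i) ` {0..<q}"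
    by (simp only: image_image)
  also have "(\<lambda>i. q - 1 - i) ` {0..<q} = {0..<q}"
    by (auto intro: image_eqI[of _ _ "q - 1 - _"])
  finally have C: "dual.C = ?h ` C" by (simp add: C_def)
  have hC: "?h ` dual.C = C" by (simp add: C hh)
  obtain s where s: "orbits (f_pm a (1 - a - b)) 1 = {s}" by (rule dual.orbits_one[OF phi])
  have "orbits (f_pm a b) 0 = {\<lambda>n. 1 - s n}"
    using orbits_reflect_eq[of "f_pm a (1 - a - b)" 0] s by (simp add: reflect_f_pm)
  moreover have "invariant_set (f_pm a b) = C \<union> range (\<lambda>n. 1 - s n)"
    using invariant_set_reflect[of "f_pm a (1 - a - b)"] dual.invariant_set_f_pm_one[OF phi s] hC
    by (simp add: reflect_f_pm image_Un image_image)
  moreover have "periodic_orbit (single (f_plus a b)) C"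
    using periodic_orbit_reflect[OF dual.periodic_orbit_f_minus[OF dual.one_notin_C[OF phi]]] hC
    by (simp add: reflect_f_minus)
  moreover have "\<not> periodic_orbit (single (f_minus a b)) D" for D
  proof
    assume "periodic_orbit (single (f_minus a b)) D"
    then have "periodic_orbit (single (f_plus a (1 - a - b))) (?h ` D)"
      using periodic_orbit_reflect[of "single (f_minus a b)" D]
      by (metis reflect_f_plus reflect_reflect)
    then show False using dual.not_periodic_orbit_f_plus[OF phi] by blast
  qed
  moreover have "invariant_set (single (f_plus a b)) = C"
    using invariant_set_reflect[of "single (f_minus a (1 - a - b))"]
      dual.invariant_set_f_minus[OF dual.one_notin_C[OF phi]] hC
    by (simp add: reflect_f_minus)
  moreover have "invariant_set (single (f_minus a b)) = {}"
    using invariant_set_reflect[of "single (f_plus a (1 - a - b))"]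
      dual.invariant_set_f_plus_empty[OF phi]
    by (simp add: reflect_f_plus)
  moreover have "1 \<in> C" using assms one_in_C_iff by simp
  moreover have "0 \<notin> C"
    using assms zero_in_C_iff phi_add_q[of "- 1"] phi_less[of "- 1" 0] by simp
  ultimately show ?thesis by blast
qed

theorem theorem8p2:
  fixes a b \<rho> :: real
  assumes "0 < a" "a < 1"
    and "0 \<le> \<rho>" "\<rho> < 1" "\<rho> \<in> \<rat>"
    and "0 \<le> b" "b < 1"
  shows
   "(has_rotation_number a b \<rho> \<longleftrightarrow>
       b = b_minus a \<rho> \<or> (b_minus a \<rho> < b \<and> b < b_plus a \<rho>) \<or> b = b_plus a \<rho>) \<and>
    (b = b_minus a \<rho> \<or> (b_minus a \<rho> < b \<and> b < b_plus a \<rho>) \<or> b = b_plus a \<rho> \<longrightarrow>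
      (\<exists>C. unique_periodic_orbit (f_pm a b) C \<and>
        (b = b_minus a \<rho> \<longrightarrow>
           0 \<in> C \<and> 1 \<notin> C \<and>
           periodic_orbit (single (f_minus a b)) C \<and>
           \<not> (\<exists>D. periodic_orbit (single (f_plus a b)) D) \<and>
           invariant_set (single (f_minus a b)) = C \<and>
           invariant_set (single (f_plus a b)) = {} \<and>
           (\<exists>s. orbits (f_pm a b) 1 = {s} \<and> invariant_set (f_pm a b) = C \<union> range s)) \<and>
        (b_minus a \<rho> < b \<and> b < b_plus a \<rho> \<longrightarrow>
           0 \<notin> C \<and> 1 \<notin> C \<and>
           invariant_set (f_pm a b) = C \<and>
           invariant_set (single (f_plus a b)) = C \<and>
           invariant_set (single (f_minus a b)) = C) \<and>
        (b = b_plus a \<rho> \<longrightarrow>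
           1 \<in> C \<and> 0 \<notin> C \<and>
           periodic_orbit (single (f_plus a b)) C \<and>
           \<not> (\<exists>D. periodic_orbit (single (f_minus a b)) D) \<and>
           invariant_set (single (f_plus a b)) = C \<and>
           invariant_set (single (f_minus a b)) = {} \<and>
           (\<exists>s. orbits (f_pm a b) 0 = {s} \<and> invariant_set (f_pm a b) = C \<union> range s)) \<and>
        (\<forall>x\<in>{0..1}. \<forall>s\<in>orbits (f_pm a b) x. converges_to_periodic_orbit (f_pm a b) s C) \<and>
        (\<forall>x\<in>{0..1}. omega_limit (f_pm a b) x = C \<and>
           omega_limit (single (f_minus a b)) x = C \<and>
           omega_limit (single (f_plus a b)) x = C)))"
proof -
  let ?cases = "b = b_minus a \<rho> \<or> (b_minus a \<rho> < b \<and> b < b_plus a \<rho>) \<or> b = b_plus a \<rho>"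
  obtain p q :: int where pq: "q > 0" "coprime p q" and \<rho>: "\<rho> = of_int p / of_int q"
    using Rats_cases'[OF assms(5)] by metis
  interpret rotation a b p q
    using assms pq by unfold_locales
  \<comment> \<open>In terms of the parameters this says \<open>b_- < b_+\<close>, so the three
    cases exclude each other and together form a closed interval.\<close>
  have less: "phi (q - 1) < phi 0 + 1"
    using phi_add_q[of "- 1"] phi_less[of "- 1" 0] by simp
  have minus: "b = b_minus a \<rho> \<longleftrightarrow> phi 0 = 0" "b_minus a \<rho> < b \<longleftrightarrow> 0 < phi 0"
    using assms(2) by (auto simp: phi_0_eq \<rho> zero_less_divide_iff)
  have plus: "b = b_plus a \<rho> \<longleftrightarrow> phi (q - 1) = 1" "b < b_plus a \<rho> \<longleftrightarrow> phi (q - 1) < 1"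
    using assms(2) by (auto simp: phi_q_eq \<rho> divide_less_0_iff)
  have locked_iff: "?cases \<longleftrightarrow> 0 \<le> phi 0 \<and> phi (q - 1) \<le> 1"
    unfolding minus plus using less by linarith
  have rot: "has_rotation_number a b \<rho>" if ?cases
  proof -
    interpret locked_rotation a b p q using that locked_iff by unfold_locales auto
    show ?thesis
      using lifted_orbit_rotation[OF lifted_orbit_lift_minus] lifted_orbit_lift_plus[of a b]
        lifted_orbit_rotation assms(3,4) unfolding has_rotation_number_def \<rho> by blast
  qed
  moreover have "?cases" if "has_rotation_number a b \<rho>"
  proof -
    \<comment> \<open>The averages of \<open>lift_minus\<close> exclude parameters below
      \<open>b_-\<close>, those of \<open>lift_plus\<close> parameters above
      \<open>b_+\<close>.\<close>
    have "\<not> phi 0 < 0" "\<not> 1 < phi (q - 1)"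
      using that lift_minus_not_rotation lift_plus_not_rotation
      unfolding has_rotation_number_def \<rho> by blast+
    then show ?thesis unfolding locked_iff by simp
  qed
  moreover have "\<exists>C. unique_periodic_orbit (f_pm a b) C \<and>
        (b = b_minus a \<rho> \<longrightarrow>
           0 \<in> C \<and> 1 \<notin> C \<and>
           periodic_orbit (single (f_minus a b)) C \<and>
           \<not> (\<exists>D. periodic_orbit (single (f_plus a b)) D) \<and>
           invariant_set (single (f_minus a b)) = C \<and>
           invariant_set (single (f_plus a b)) = {} \<and>
           (\<exists>s. orbits (f_pm a b) 1 = {s} \<and> invariant_set (f_pm a b) = C \<union> range s)) \<and>
        (b_minus a \<rho> < b \<and> b < b_plus a \<rho> \<longrightarrow>
           0 \<notin> C \<and> 1 \<notin> C \<and>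
           invariant_set (f_pm a b) = C \<and>
           invariant_set (single (f_plus a b)) = C \<and>
           invariant_set (single (f_minus a b)) = C) \<and>
        (b = b_plus a \<rho> \<longrightarrow>
           1 \<in> C \<and> 0 \<notin> C \<and>
           periodic_orbit (single (f_plus a b)) C \<and>
           \<not> (\<exists>D. periodic_orbit (single (f_minus a b)) D) \<and>
           invariant_set (single (f_plus a b)) = C \<and>
           invariant_set (single (f_minus a b)) = {} \<and>
           (\<exists>s. orbits (f_pm a b) 0 = {s} \<and> invariant_set (f_pm a b) = C \<union> range s)) \<and>
        (\<forall>x\<in>{0..1}. \<forall>s\<in>orbits (f_pm a b) x. converges_to_periodic_orbit (f_pm a b) s C) \<and>
        (\<forall>x\<in>{0..1}. omega_limit (f_pm a b) x = C \<and>
           omega_limit (single (f_minus a b)) x = C \<and>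
           omega_limit (single (f_plus a b)) x = C)" if ?cases
  proof -
    interpret locked_rotation a b p q using that locked_iff by unfold_locales auto
    show ?thesis
    proof (rule exI[of _ C], intro conjI impI ballI)
      show "unique_periodic_orbit (f_pm a b) C" by (rule unique_periodic_orbit_C)
      show "\<exists>s. orbits (f_pm a b) 1 = {s} \<and> invariant_set (f_pm a b) = C \<union> range s"
        if "b = b_minus a \<rho>"
      proof -
        have phi_0: "phi 0 = 0" using minus that by simp
        obtain s where "orbits (f_pm a b) 1 = {s}" by (rule orbits_one[OF phi_0])
        then show ?thesis using invariant_set_f_pm_one[OF phi_0] by blast
      qed
      show "converges_to_periodic_orbit (f_pm a b) s C" if "s \<in> orbits (f_pm a b) x" for x s
        using that by (rule orbit_converges)
      show "omega_limit (f_pm a b) x = C" "omega_limit (single (f_minus a b)) x = C"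
        "omega_limit (single (f_plus a b)) x = C" if "x \<in> {0..1}" for x
        using that
        by (rule omega_limit_eq_C[OF order.refl f_pm_nonempty]
            omega_limit_eq_C[OF single_f_minus_subset single_nonempty]
            omega_limit_eq_C[OF single_f_plus_subset single_nonempty])+
    qed (use minus plus zero_in_C one_notin_C zero_in_C_iff one_in_C_iff periodic_orbit_f_minus
        not_periodic_orbit_f_plus invariant_set_f_minus invariant_set_f_plus_empty
        invariant_set_f_pm invariant_set_f_plus phi_q_case in \<open>simp_all\<close>)
  qed
  ultimately show ?thesis by blast
qed

end
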